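(* Let $\Omega$ be an open subset of $\mathbb R^{d}$. Then $\mathcal G(\Omega)=\widetilde{\mathcal G}(\widetilde\Omega_c)$, in the sense that the map assigning to $u=[u_\varepsilon]\in\mathcal G(\Omega)$ the function $\widetilde\Omega_c\to\widetilde{\mathbb R}$, $[x_\varepsilon]\mapsto[u_\varepsilon(x_\varepsilon)]$, is a well-defined bijection from $\mathcal G(\Omega)$ onto the set $\widetilde{\mathcal G}(\widetilde\Omega_c)$ of all generalized smooth functions $\widetilde\Omega_c\to\widetilde{\mathbb R}$.
   Context: Let $I=(0,1]$; all asymptotics are for $\varepsilon\to0^+$, and "for $\varepsilon$ small" means for all $\varepsilon\in(0,\varepsilon_0]$ for some $\varepsilon_0\in I$. $\mathbb R^n_M$ is the set of moderate nets: $(x_\varepsilon)\in(\mathbb R^n)^I$ with $|x_\varepsilon|=O(\varepsilon^{-N})$ for some $N\in\mathbb N$. Write $(x_\varepsilon)\sim(y_\varepsilon)$ if $|x_\varepsilon-y_\varepsilon|=O(\varepsilon^m)$ for all $m\in\mathbb N$; $\widetilde{\mathbb R}^n=\mathbb R^n_M/\!\sim$, with classes $[x_\varepsilon]$. Colombeau algebra: $\mathcal G(\Omega)=\mathcal E_M(\Omega)/\mathcal N(\Omega)$, where $\mathcal E_M(\Omega)$ is the set of nets $(u_\varepsilon)\in\mathcal C^\infty(\Omega)^I$ (real-valued) such that for every compact $K\subseteq\Omega$ and $\alpha\in\mathbb N^d$ there is $N\in\mathbb N$ with $\sup_{x\in K}|\partial^\alpha u_\varepsilon(x)|=O(\varepsilon^{-N})$,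 and $\mathcal N(\Omega)$ is the set of nets such that for every compact $K\subseteq\Omega$, $\alpha\in\mathbb N^d$ and $m\in\mathbb N$, $\sup_{x\in K}|\partial^\alpha u_\varepsilon(x)|=O(\varepsilon^{m})$. $\widetilde\Omega_c\subseteq\widetilde{\mathbb R}^d$ is the set of compactly supported generalized points: classes $[x_\varepsilon]$ of nets $(x_\varepsilon)\in\Omega^I$ for which there is a compact $K\subseteq\Omega$ with $x_\varepsilon\in K$ for $\varepsilon$ small. For a net $(A_\varepsilon)$ of subsets of $\mathbb R^n$, $\langle A_\varepsilon\rangle$ is the set of all $x\in\widetilde{\mathbb R}^n$ such that every representative $(x_\varepsilon)$ of $x$ satisfies $x_\varepsilon\in A_\varepsilon$ for $\varepsilon$ small. Let $X\subseteq\widetilde{\mathbb R}^n$, $Y\subseteq\widetilde{\mathbb R}^k$, $(\Omega_\varepsilon)$ a net of open subsets of $\mathbb R^n$ and $u_\varepsilon\in\mathcal C^\infty(\Omega_\varepsilon,\mathbb R^k)$. The net $(u_\varepsilon)$ defines a generalized smooth map $X\to Y$ if $X\subseteq\langle\Omega_\varepsilon\rangle$, and for every $x\in X$ and every representative $(x_\varepsilon)$ of $x$ (with $x_\varepsilon\in\Omega_\varepsilon$ for $\varepsilon$ small) one has $[u_\varepsilon(x_\varepsilon)]\in Y$ and $(\partial^\alpha u_\varepsilon(x_\varepsilon))\in\mathbb R^k_M$ for all $\alpha\in\mathbb N^n$. A map $f:X\to Y$ is a generalized smooth function if there are such $(\Omega_\varepsilon)$, $(u_\varepsilon)$ with $(u_\varepsilon)$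 defining a generalized smooth map $X\to Y$ and $f([x_\varepsilon])=[u_\varepsilon(x_\varepsilon)]$ for all $[x_\varepsilon]\in X$. *)

theory Defs
  imports "HOL-Analysis.Analysis" "HOL-Library.Landau_Symbols"
begin

subsection \<open>Smooth functions and partial derivatives\<close>

definition partial :: "'n::finite \<Rightarrow> (real ^ 'n \<Rightarrow> 'b::real_normed_vector) \<Rightarrow> real ^ 'n \<Rightarrow> 'b" where
  "partial i f = (\<lambda>x. frechet_derivative f (at x) (axis i 1))"

text \<open>The operator \<open>\<partial>\<^sup>\<alpha>\<close> composes the iterated partial derivatives in one fixed but arbitrary order of
  the coordinates; for smooth functions on open sets the order is immaterial.\<close>

definition coord_list :: "'n::finite list" where
  "coord_list = (SOME is. distinct is \<and> set is = UNIV)"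

definition multi_partial ::
  "('n::finite \<Rightarrow> nat) \<Rightarrow> (real ^ 'n \<Rightarrow> 'b::real_normed_vector) \<Rightarrow> real ^ 'n \<Rightarrow> 'b" where
  "multi_partial \<alpha> f = foldr (\<lambda>i. partial i ^^ \<alpha> i) coord_list f"

text \<open>These two notions are meant for open \<open>S\<close> only. Functions on \<open>S\<close> are represented by total functions
  whose values outside \<open>S\<close> are irrelevant.\<close>

primrec C_k_on :: "nat \<Rightarrow> (real ^ 'n::finite) set \<Rightarrow> (real ^ 'n \<Rightarrow> 'b::real_normed_vector) \<Rightarrow> bool" where
  "C_k_on 0 S f \<longleftrightarrow> continuous_on S f"
| "C_k_on (Suc k) S f \<longleftrightarrow> (\<forall>x\<in>S. f differentiable (at x)) \<and> (\<forall>i. C_k_on k S (partial i f))"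

definition smooth_on :: "(real ^ 'n::finite) set \<Rightarrow> (real ^ 'n \<Rightarrow> 'b::real_normed_vector) \<Rightarrow> bool" where
  "smooth_on S f \<longleftrightarrow> (\<forall>k. C_k_on k S f)"

subsection \<open>Generalized points\<close>

text \<open>A net indexed by \<open>I = (0,1]\<close> is represented by a function on \<open>real\<close> whose values outside \<open>I\<close> are
  irrelevant: all notions below depend only on small positive \<open>\<epsilon>\<close> or quantify explicitly over \<open>I\<close>.
  The filter \<open>at_right 0\<close> expresses both asymptotics as \<open>\<epsilon> \<rightarrow> 0+\<close> and ``for \<open>\<epsilon>\<close> small''.\<close>

definition moderate_nets :: "(real \<Rightarrow> 'a::real_normed_vector) set" where
  "moderate_nets = {x. \<exists>N::nat. (\<lambda>\<epsilon>. norm (x \<epsilon>)) \<in> O[at_right 0](\<lambda>\<epsilon>. 1 / \<epsilon> ^ N)}"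

definition net_rel :: "((real \<Rightarrow> 'a::real_normed_vector) \<times> (real \<Rightarrow> 'a)) set" where
  "net_rel = {(x, y). x \<in> moderate_nets \<and> y \<in> moderate_nets \<and>
     (\<forall>m::nat. (\<lambda>\<epsilon>. norm (x \<epsilon> - y \<epsilon>)) \<in> O[at_right 0](\<lambda>\<epsilon>. \<epsilon> ^ m))}"

text \<open>A generalized point is the set of all its representatives.\<close>

definition gen_space :: "(real \<Rightarrow> 'a::euclidean_space) set set" where
  "gen_space = moderate_nets // net_rel"

definition net_class :: "(real \<Rightarrow> 'a::euclidean_space) \<Rightarrow> (real \<Rightarrow> 'a) set" where
  "net_class x = net_rel `` {x}"

definition compact_gen_points :: "'a::euclidean_space set \<Rightarrow> (real \<Rightarrow> 'a) set set" where
  "compact_gen_points \<Omega> = {net_class x |x. x \<in> moderate_nets \<and> (\<forall>\<epsilon>\<in>{0<..1}. x \<epsilon> \<in> \<Omega>) \<and>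
     (\<exists>K. compact K \<and> K \<subseteq> \<Omega> \<and> (\<forall>\<^sub>F \<epsilon> in at_right 0. x \<epsilon> \<in> K))}"

definition strongly_internal :: "(real \<Rightarrow> 'a::euclidean_space set) \<Rightarrow> (real \<Rightarrow> 'a) set set" where
  "strongly_internal A = {p \<in> gen_space. \<forall>x\<in>p. \<forall>\<^sub>F \<epsilon> in at_right 0. x \<epsilon> \<in> A \<epsilon>}"

subsection \<open>Colombeau algebra\<close>

text \<open>The empty compact set is excluded because \<open>Sup {}\<close> is unspecified on the reals.\<close>

definition colombeau_moderate :: "(real ^ 'd::finite) set \<Rightarrow> (real \<Rightarrow> real ^ 'd \<Rightarrow> real) set" where
  "colombeau_moderate \<Omega> = {u. (\<forall>\<epsilon>\<in>{0<..1}. smooth_on \<Omega> (u \<epsilon>)) \<and>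
     (\<forall>K \<alpha>. compact K \<and> K \<noteq> {} \<and> K \<subseteq> \<Omega> \<longrightarrow>
        (\<exists>N::nat. (\<lambda>\<epsilon>. SUP x\<in>K. \<bar>multi_partial \<alpha> (u \<epsilon>) x\<bar>) \<in> O[at_right 0](\<lambda>\<epsilon>. 1 / \<epsilon> ^ N)))}"

definition colombeau_negligible :: "(real ^ 'd::finite) set \<Rightarrow> (real \<Rightarrow> real ^ 'd \<Rightarrow> real) set" where
  "colombeau_negligible \<Omega> = {u. (\<forall>\<epsilon>\<in>{0<..1}. smooth_on \<Omega> (u \<epsilon>)) \<and>
     (\<forall>K \<alpha>. compact K \<and> K \<noteq> {} \<and> K \<subseteq> \<Omega> \<longrightarrow>
        (\<forall>m::nat. (\<lambda>\<epsilon>. SUP x\<in>K. \<bar>multi_partial \<alpha> (u \<epsilon>) x\<bar>) \<in> O[at_right 0](\<lambda>\<epsilon>. \<epsilon> ^ m)))}"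

definition colombeau_rel ::
  "(real ^ 'd::finite) set \<Rightarrow> ((real \<Rightarrow> real ^ 'd \<Rightarrow> real) \<times> (real \<Rightarrow> real ^ 'd \<Rightarrow> real)) set" where
  "colombeau_rel \<Omega> = {(u, v). u \<in> colombeau_moderate \<Omega> \<and> v \<in> colombeau_moderate \<Omega> \<and>
     (\<lambda>\<epsilon> x. u \<epsilon> x - v \<epsilon> x) \<in> colombeau_negligible \<Omega>}"

definition colombeau_algebra :: "(real ^ 'd::finite) set \<Rightarrow> (real \<Rightarrow> real ^ 'd \<Rightarrow> real) set set" where
  "colombeau_algebra \<Omega> = colombeau_moderate \<Omega> // colombeau_rel \<Omega>"

definition colombeau_class ::
  "(real ^ 'd::finite) set \<Rightarrow> (real \<Rightarrow> real ^ 'd \<Rightarrow> real) \<Rightarrow> (real \<Rightarrow> real ^ 'd \<Rightarrow> real) set" where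
  "colombeau_class \<Omega> u = colombeau_rel \<Omega> `` {u}"

subsection \<open>Generalized smooth functions\<close>

definition defines_gsm ::
  "(real \<Rightarrow> real ^ 'n::finite) set set \<Rightarrow> (real \<Rightarrow> 'b::euclidean_space) set set \<Rightarrow>
   (real \<Rightarrow> (real ^ 'n) set) \<Rightarrow> (real \<Rightarrow> real ^ 'n \<Rightarrow> 'b) \<Rightarrow> bool" where
  "defines_gsm X Y \<Omega> u \<longleftrightarrow>
     (\<forall>\<epsilon>\<in>{0<..1}. open (\<Omega> \<epsilon>) \<and> smooth_on (\<Omega> \<epsilon>) (u \<epsilon>)) \<and>
     X \<subseteq> strongly_internal \<Omega> \<and>
     (\<forall>p\<in>X. \<forall>x\<in>p. net_class (\<lambda>\<epsilon>. u \<epsilon> (x \<epsilon>)) \<in> Y \<and>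
        (\<forall>\<alpha>. (\<lambda>\<epsilon>. multi_partial \<alpha> (u \<epsilon>) (x \<epsilon>)) \<in> moderate_nets))"

definition gen_smooth_funs ::
  "(real \<Rightarrow> real ^ 'n::finite) set set \<Rightarrow> (real \<Rightarrow> 'b::euclidean_space) set set \<Rightarrow>
   ((real \<Rightarrow> real ^ 'n) set \<Rightarrow> (real \<Rightarrow> 'b) set) set" where
  "gen_smooth_funs X Y = {f \<in> X \<rightarrow>\<^sub>E Y. \<exists>\<Omega> u. defines_gsm X Y \<Omega> u \<and>
     (\<forall>p\<in>X. \<forall>x\<in>p. f p = net_class (\<lambda>\<epsilon>. u \<epsilon> (x \<epsilon>)))}"

text \<open>Evaluation of a Colombeau generalized function at compactly supported generalized points; all members
  of the union coincide once evaluation is known to respect the equivalence relations.\<close>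

definition colombeau_eval ::
  "(real ^ 'd::finite) set \<Rightarrow> (real \<Rightarrow> real ^ 'd \<Rightarrow> real) set \<Rightarrow>
   (real \<Rightarrow> real ^ 'd) set \<Rightarrow> (real \<Rightarrow> real) set" where
  "colombeau_eval \<Omega> U = (\<lambda>p\<in>compact_gen_points \<Omega>. \<Union>u\<in>U. \<Union>x\<in>p. net_class (\<lambda>\<epsilon>. u \<epsilon> (x \<epsilon>)))"

end

theory Submission
  imports Defs "HOL-Computational_Algebra.Polynomial"
begin

text \<open>
  Compactly supported generalized points see every net of points in a compact set. Since a
  continuous function attains its maximum on a compact set \<open>K\<close>, one can evaluate a net of functions
  along a net of maximizers: a growth condition that holds at all points holds uniformly on \<open>K\<close>
  (\<open>locally_moderate_if_moderate_at_points\<close>, \<open>locally_negligible_if_negligible_at_points\<close>). This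
  translation between point values and uniform estimates carries the theorem.

  Evaluation is well defined because the gradient of a moderate net is moderate on compact sets,
  and the distance between two representatives of a point is negligible
  (\<open>negligible_net_eval_diff\<close>).

  For injectivity, equal point values make \<open>u - v\<close> uniformly negligible on compact sets. Landau's
  inequality bounds a first derivative by the function and its second derivative in the same
  direction, so negligibility passes from a moderate net to all its derivatives
  (\<open>negligible_if_moderate_and_locally_negligible\<close>).

  For surjectivity, a generalized smooth function comes with functions \<open>u \<epsilon>\<close> on domains that depend on
  \<open>\<epsilon>\<close>. Every compact subset of \<open>\<Omega>\<close> lies in these domains for small \<open>\<epsilon>\<close>, again by testing on a suitable
  net. Multiplication by cutoffs along an exhaustion of \<open>\<Omega>\<close>, with an index that grows slowly enough as
  \<open>\<epsilon>\<close> tends to \<open>0\<close>, yields functions on all of \<open>\<Omega>\<close> that agree with \<open>u \<epsilon>\<close> near any given compact set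
  (\<open>gen_smooth_fun_has_global_net\<close>); they form a moderate net by the translation above.
\<close>

section \<open>Calculus of smooth functions\<close>

lemma frechet_derivative_cong_open:
  assumes "open S" "x \<in> S" "\<And>y. y \<in> S \<Longrightarrow> f y = g y"
  shows "frechet_derivative f (at x) = frechet_derivative g (at x)"
proof -
  have "(f has_derivative D) (at x) \<longleftrightarrow> (g has_derivative D) (at x)" for D
    using has_derivative_transform_within_open[OF _ assms(1,2), of f D UNIV g]
      has_derivative_transform_within_open[OF _ assms(1,2), of g D UNIV f] assms(3) by auto
  then show ?thesis unfolding frechet_derivative_def by presburger
qed

lemma partial_cong:
  assumes "open S" "x \<in> S" "\<And>y. y \<in> S \<Longrightarrow> f y = g y"
  shows "partial i f x = partial i g x"
  using frechet_derivative_cong_open[OF assms, of "\<lambda>y. y"] by (simp add: partial_def)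

lemma partial_eqI:
  assumes "(f has_derivative D) (at x)"
  shows "partial i f x = D (axis i 1)"
  using frechet_derivative_at[OF assms] by (simp add: partial_def)

lemma C_k_on_cong:
  assumes "open S" "\<And>x. x \<in> S \<Longrightarrow> f x = g x" "C_k_on k S f"
  shows "C_k_on k S g"
  using assms(2,3)
proof (induction k arbitrary: f g)
  case 0
  then show ?case using continuous_on_cong[OF refl, of S f g] by simp
next
  case (Suc k)
  have "g differentiable (at x)" if "x \<in> S" for x
    using Suc.prems that has_derivative_transform_within_open[OF _ assms(1) that, of f _ UNIV g]
    unfolding differentiable_def by (metis C_k_on.simps(2) differentiable_def)
  moreover have "C_k_on k S (partial i g)" for i
    using Suc.prems Suc.IH[of "partial i f" "partial i g"] partial_cong[OF assms(1)]
    by (metis C_k_on.simps(2))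
  ultimately show ?case by simp
qed

lemma C_k_on_subset: "C_k_on k S f \<Longrightarrow> T \<subseteq> S \<Longrightarrow> C_k_on k T f"
  by (induction k arbitrary: f) (auto intro: continuous_on_subset)

lemma C_k_on_SucD: "C_k_on (Suc k) S f \<Longrightarrow> C_k_on k S f"
proof (induction k arbitrary: f)
  case 0
  then show ?case
    by (auto intro!: continuous_at_imp_continuous_on differentiable_imp_continuous_within)
next
  case (Suc k)
  then have "\<forall>i. C_k_on (Suc k) S (partial i f)" and d: "\<forall>x\<in>S. f differentiable (at x)"
    by auto
  then have "\<forall>i. C_k_on k S (partial i f)" using Suc.IH by blast
  with d show ?case by simp
qed

lemma C_k_on_Un:
  assumes "open S" "open T" "C_k_on k S f" "C_k_on k T f"
  shows "C_k_on k (S \<union> T) f"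
  using assms(3,4)
  by (induction k arbitrary: f) (auto intro: continuous_on_open_Un[OF assms(1,2)])

lemma C_k_on_const: "C_k_on k (S :: (real ^ 'a) set) (\<lambda>x. c)"
proof (induction k arbitrary: c)
  case (Suc k)
  have "partial i (\<lambda>x. c) = (\<lambda>x. 0)" for i :: 'a
    by (rule ext) (rule partial_eqI[OF has_derivative_const, THEN trans], simp)
  with Suc show ?case by simp
qed simp

lemma C_k_on_nth: "C_k_on k (S :: (real ^ 'a) set) (\<lambda>x. x $ j)"
proof (cases k)
  case 0
  then show ?thesis by (auto intro: continuous_intros)
next
  case (Suc l)
  have d: "((\<lambda>x. x $ j) has_derivative (\<lambda>x. x $ j)) (at x)" for x :: "real ^ 'a"
    by (intro bounded_linear_imp_has_derivative bounded_linear_vec_nth)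
  have "partial i (\<lambda>x. x $ j) = (\<lambda>x. axis i 1 $ j)" for i :: 'a
    by (rule ext) (rule partial_eqI[OF d])
  with d show ?thesis unfolding Suc C_k_on.simps
    by (auto simp: differentiable_def C_k_on_const)
qed

lemma partial_add:
  assumes "f differentiable (at x)" "g differentiable (at x)"
  shows "partial i (\<lambda>x. f x + g x) x = partial i f x + partial i g x"
  using has_derivative_add[OF assms[unfolded frechet_derivative_works]]
  by (subst partial_eqI, assumption) (simp add: partial_def)

lemma partial_diff:
  assumes "f differentiable (at x)" "g differentiable (at x)"
  shows "partial i (\<lambda>x. f x - g x) x = partial i f x - partial i g x"
  using has_derivative_diff[OF assms[unfolded frechet_derivative_works]]
  by (subst partial_eqI, assumption) (simp add: partial_def)

lemma partial_mult:
  fixes f g :: "real ^ 'n \<Rightarrow> real"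
  assumes "f differentiable (at x)" "g differentiable (at x)"
  shows "partial i (\<lambda>x. f x * g x) x = f x * partial i g x + partial i f x * g x"
  using has_derivative_mult[OF assms[unfolded frechet_derivative_works]]
  by (subst partial_eqI, assumption) (simp add: partial_def)

lemma C_k_on_add:
  assumes "open S" "C_k_on k S f" "C_k_on k S g"
  shows "C_k_on k S (\<lambda>x. f x + g x)"
  using assms(2,3)
proof (induction k arbitrary: f g)
  case (Suc k)
  have "C_k_on k S (partial i (\<lambda>x. f x + g x))" for i
    by (rule C_k_on_cong[OF assms(1) _ Suc.IH[of "partial i f" "partial i g"]])
      (use Suc.prems in \<open>auto simp: partial_add\<close>)
  with Suc.prems show ?case by auto
qed (auto intro: continuous_intros)

lemma C_k_on_diff:
  assumes "open S" "C_k_on k S f" "C_k_on k S g"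
  shows "C_k_on k S (\<lambda>x. f x - g x)"
  using assms(2,3)
proof (induction k arbitrary: f g)
  case (Suc k)
  have "C_k_on k S (partial i (\<lambda>x. f x - g x))" for i
    by (rule C_k_on_cong[OF assms(1) _ Suc.IH[of "partial i f" "partial i g"]])
      (use Suc.prems in \<open>auto simp: partial_diff\<close>)
  with Suc.prems show ?case by auto
qed (auto intro: continuous_intros)

lemma C_k_on_mult:
  fixes f g :: "real ^ 'n \<Rightarrow> real"
  assumes "open S" "C_k_on k S f" "C_k_on k S g"
  shows "C_k_on k S (\<lambda>x. f x * g x)"
  using assms(2,3)
proof (induction k arbitrary: f g)
  case (Suc k)
  have "C_k_on k S f" "C_k_on k S g" using Suc.prems C_k_on_SucD by blast+
  then have "C_k_on k S (\<lambda>x. f x * partial i g x + partial i f x * g x)" for i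
    using Suc.prems by (intro C_k_on_add assms(1) Suc.IH) auto
  then have "C_k_on k S (partial i (\<lambda>x. f x * g x))" for i
    by (rule C_k_on_cong[OF assms(1), rotated]) (use Suc.prems in \<open>auto simp: partial_mult\<close>)
  with Suc.prems show ?case by auto
qed (auto intro: continuous_intros)

text \<open>The outer function is given together with all its derivatives, as a sequence \<open>F\<close> with
  \<open>F n' = F (Suc n)\<close>. Then each derivative of the composite is a product of a derivative of \<open>f\<close>
  and a composite of the same kind with \<open>n\<close> raised by one, so the induction on \<open>k\<close> closes.\<close>

lemma C_k_on_compose_real:
  fixes f :: "real ^ 'n \<Rightarrow> real" and F :: "nat \<Rightarrow> real \<Rightarrow> real"
  assumes "open S" and F: "\<And>n t. t \<in> T \<Longrightarrow> (F n has_real_derivative F (Suc n) t) (at t)"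
    and "f ` S \<subseteq> T" "C_k_on k S f"
  shows "C_k_on k S (\<lambda>x. F n (f x))"
  using assms(4)
proof (induction k arbitrary: n)
  case 0
  have "continuous_on T (F n)"
    using F by (auto intro!: continuous_at_imp_continuous_on DERIV_isCont)
  with 0 assms(3) show ?case by (auto intro: continuous_on_compose2)
next
  case (Suc k)
  have "((\<lambda>y. F n (f y)) has_derivative (\<lambda>v. frechet_derivative f (at x) v * F (Suc n) (f x))) (at x)"
    if "x \<in> S" for x
    using that assms(3) Suc.prems by (intro DERIV_compose_FDERIV F)
      (auto simp: frechet_derivative_works[symmetric])
  then have d: "((\<lambda>y. F n (f y)) has_derivative (\<lambda>v. frechet_derivative f (at x) v * F (Suc n) (f x))) (at x)"
    if "x \<in> S" for x using that by blast
  have "C_k_on k S (partial i (\<lambda>x. F n (f x)))" for i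
  proof -
    have "C_k_on k S (\<lambda>x. partial i f x * F (Suc n) (f x))"
      using Suc.prems C_k_on_SucD by (intro C_k_on_mult assms(1) Suc.IH) auto
    then show ?thesis
      by (rule C_k_on_cong[OF assms(1), rotated]) (simp add: partial_eqI[OF d], simp add: partial_def)
  qed
  with d show ?case by (auto simp: differentiable_def)
qed

lemma smooth_on_cong: "open S \<Longrightarrow> (\<And>x. x \<in> S \<Longrightarrow> f x = g x) \<Longrightarrow> smooth_on S f \<Longrightarrow> smooth_on S g"
  unfolding smooth_on_def by (metis C_k_on_cong)

lemma smooth_on_subset: "smooth_on S f \<Longrightarrow> T \<subseteq> S \<Longrightarrow> smooth_on T f"
  unfolding smooth_on_def by (metis C_k_on_subset)

lemma smooth_on_Un: "open S \<Longrightarrow> open T \<Longrightarrow> smooth_on S f \<Longrightarrow> smooth_on T f \<Longrightarrow> smooth_on (S \<union> T) f"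
  unfolding smooth_on_def by (metis C_k_on_Un)

lemma smooth_on_const: "smooth_on S (\<lambda>x. c)"
  unfolding smooth_on_def by (metis C_k_on_const)

lemma smooth_on_nth: "smooth_on S (\<lambda>x. x $ j)"
  unfolding smooth_on_def by (metis C_k_on_nth)

lemma smooth_on_add: "open S \<Longrightarrow> smooth_on S f \<Longrightarrow> smooth_on S g \<Longrightarrow> smooth_on S (\<lambda>x. f x + g x)"
  unfolding smooth_on_def by (metis C_k_on_add)

lemma smooth_on_diff: "open S \<Longrightarrow> smooth_on S f \<Longrightarrow> smooth_on S g \<Longrightarrow> smooth_on S (\<lambda>x. f x - g x)"
  unfolding smooth_on_def by (metis C_k_on_diff)

lemma smooth_on_mult:
  fixes f g :: "real ^ 'n \<Rightarrow> real"
  shows "open S \<Longrightarrow> smooth_on S f \<Longrightarrow> smooth_on S g \<Longrightarrow> smooth_on S (\<lambda>x. f x * g x)"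
  unfolding smooth_on_def by (metis C_k_on_mult)

lemma smooth_on_sum:
  assumes "open S" "\<And>i. i \<in> A \<Longrightarrow> smooth_on S (f i)"
  shows "smooth_on S (\<lambda>x. \<Sum>i\<in>A. f i x)"
  using assms(2)
  by (induction A rule: infinite_finite_induct)
    (auto intro: smooth_on_const smooth_on_add[OF assms(1)])

lemma smooth_on_compose_real:
  fixes f :: "real ^ 'n \<Rightarrow> real" and F :: "nat \<Rightarrow> real \<Rightarrow> real"
  assumes "open S" "\<And>n t. t \<in> T \<Longrightarrow> (F n has_real_derivative F (Suc n) t) (at t)"
    and "f ` S \<subseteq> T" "smooth_on S f"
  shows "smooth_on S (\<lambda>x. F n (f x))"
  unfolding smooth_on_def
proof
  show "C_k_on k S (\<lambda>x. F n (f x))" for k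
    by (rule C_k_on_compose_real[where F = F and f = f and T = T])
      (use assms in \<open>auto simp: smooth_on_def\<close>)
qed

lemma smooth_on_imp_continuous_on: "smooth_on S f \<Longrightarrow> continuous_on S f"
  unfolding smooth_on_def by (metis C_k_on.simps(1))

lemma smooth_on_imp_differentiable: "smooth_on S f \<Longrightarrow> x \<in> S \<Longrightarrow> f differentiable (at x)"
  unfolding smooth_on_def by (metis C_k_on.simps(2))

lemma smooth_on_partial: "smooth_on S f \<Longrightarrow> smooth_on S (partial i f)"
  unfolding smooth_on_def by (metis C_k_on.simps(2))

lemma smooth_on_partial_funpow: "smooth_on S f \<Longrightarrow> smooth_on S ((partial i ^^ n) f)"
  by (induction n) (auto intro: smooth_on_partial)

lemma smooth_on_multi_partial: "smooth_on S f \<Longrightarrow> smooth_on S (multi_partial \<alpha> f)"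
proof -
  have "smooth_on S f \<Longrightarrow> smooth_on S (foldr (\<lambda>i. partial i ^^ \<alpha> i) is f)" for "is"
    by (induction "is") (auto intro: smooth_on_partial_funpow)
  then show "smooth_on S f \<Longrightarrow> ?thesis" unfolding multi_partial_def .
qed

lemma multi_partial_cong:
  assumes "open S" "\<And>y. y \<in> S \<Longrightarrow> f y = g y" "x \<in> S"
  shows "multi_partial \<alpha> f x = multi_partial \<alpha> g x"
proof -
  have pow: "\<forall>x\<in>S. (partial i ^^ n) f x = (partial i ^^ n) g x"
    if "\<forall>x\<in>S. f x = g x" for i n and f g :: "real ^ 'a \<Rightarrow> 'b"
    using that by (induction n) (auto intro: partial_cong[OF assms(1)])
  have "\<forall>x\<in>S. foldr (\<lambda>i. partial i ^^ \<alpha> i) is f x = foldr (\<lambda>i. partial i ^^ \<alpha> i) is g x" for "is"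
  proof (induction "is")
    case (Cons i "is")
    then show ?case using pow by simp
  qed (use assms(2) in auto)
  then show ?thesis unfolding multi_partial_def using assms(3) by blast
qed

lemma multi_partial_diff:
  assumes "open S" "smooth_on S f" "smooth_on S g" "x \<in> S"
  shows "multi_partial \<alpha> (\<lambda>x. f x - g x) x = multi_partial \<alpha> f x - multi_partial \<alpha> g x"
proof -
  have pow: "\<forall>x\<in>S. (partial i ^^ n) h x = (partial i ^^ n) f x - (partial i ^^ n) g x"
    if "smooth_on S f" "smooth_on S g" "\<forall>x\<in>S. h x = f x - g x" for i n and f g h :: "real ^ 'a \<Rightarrow> 'b"
  proof (induction n)
    case (Suc n)
    show ?case
    proof
      fix x assume x: "x \<in> S"
      have "(partial i ^^ Suc n) h x = partial i (\<lambda>x. (partial i ^^ n) f x - (partial i ^^ n) g x) x"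
        using Suc by (auto intro!: partial_cong[OF assms(1) x])
      also have "\<dots> = (partial i ^^ Suc n) f x - (partial i ^^ Suc n) g x"
        using smooth_on_imp_differentiable[OF smooth_on_partial_funpow x] that
        by (subst partial_diff) auto
      finally show "(partial i ^^ Suc n) h x = (partial i ^^ Suc n) f x - (partial i ^^ Suc n) g x" .
    qed
  qed (use that in auto)
  have "smooth_on S (foldr (\<lambda>i. partial i ^^ \<alpha> i) is f) \<and> smooth_on S (foldr (\<lambda>i. partial i ^^ \<alpha> i) is g)
     \<and> (\<forall>x\<in>S. foldr (\<lambda>i. partial i ^^ \<alpha> i) is (\<lambda>x. f x - g x) x
      = foldr (\<lambda>i. partial i ^^ \<alpha> i) is f x - foldr (\<lambda>i. partial i ^^ \<alpha> i) is g x)" for "is"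
  proof (induction "is")
    case (Cons i "is")
    then show ?case using pow by (simp add: smooth_on_partial_funpow)
  qed (use assms(2,3) in auto)
  then show ?thesis unfolding multi_partial_def using assms(4) by blast
qed

lemma set_coord_list: "distinct (coord_list :: 'n::finite list) \<and> set (coord_list :: 'n list) = UNIV"
  unfolding coord_list_def by (rule someI_ex) (metis finite_distinct_list finite)

lemma foldr_partial_zero:
  "(\<And>i. i \<in> set is \<Longrightarrow> \<alpha> i = 0) \<Longrightarrow> foldr (\<lambda>i. partial i ^^ \<alpha> i) is f = f"
  by (induction "is") auto

lemma multi_partial_zero: "multi_partial (\<lambda>i. 0) f = f"
  unfolding multi_partial_def by (rule foldr_partial_zero) simp

text \<open>The operators in \<open>multi_partial\<close> are applied in the order of \<open>coord_list\<close>, its head outermost.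
  Hence only a derivative in a direction before which the multi-index vanishes can be split off.
  This replaces the symmetry of mixed partial derivatives in the induction over multi-indices.\<close>

lemma multi_partial_fun_upd:
  assumes "coord_list = is @ j # js" "\<And>i. i \<in> set is \<Longrightarrow> \<alpha> i = 0"
  shows "multi_partial (\<alpha>(j := n)) f = (partial j ^^ n) (multi_partial (\<alpha>(j := 0)) f)"
proof -
  have d: "j \<notin> set is" "j \<notin> set js"
    using set_coord_list assms(1) by (metis distinct.simps(2) distinct_append
        disjoint_iff list.set_intros(1))+
  have "foldr (\<lambda>i. partial i ^^ (\<alpha>(j := n)) i) js f = foldr (\<lambda>i. partial i ^^ \<alpha> i) js f" for n
    using d by (intro foldr_cong) auto
  moreover have "foldr (\<lambda>i. partial i ^^ (\<alpha>(j := n)) i) is h = h" for n and h :: "real ^ 'a \<Rightarrow> 'b"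
    using d assms(2) by (intro foldr_partial_zero) auto
  ultimately show ?thesis unfolding multi_partial_def assms(1) by simp
qed

lemma multi_partial_axis: "multi_partial ((\<lambda>i. 0)(j := n)) f = (partial j ^^ n) f"
proof -
  obtain "is" js where "coord_list = is @ j # js"
    using set_coord_list split_list by (metis UNIV_I)
  from multi_partial_fun_upd[OF this, of "\<lambda>i. 0" n f] show ?thesis
    by (simp add: fun_upd_idem multi_partial_zero)
qed

section \<open>Smooth cutoff functions\<close>

text \<open>The \<open>n\<close>-th derivative of \<open>exp (- 1 / t)\<close> at \<open>t > 0\<close> is \<open>bump_poly n\<close> evaluated at \<open>1 / t\<close>, times
  \<open>exp (- 1 / t)\<close>.\<close>

fun bump_poly :: "nat \<Rightarrow> real poly" where
  "bump_poly 0 = 1"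
| "bump_poly (Suc n) = monom 1 2 * (bump_poly n - pderiv (bump_poly n))"

text \<open>The sequence of derivatives of the standard smooth function that is flat at \<open>0\<close>; the function itself
  is \<open>flat_deriv 0\<close>.\<close>

definition flat_deriv :: "nat \<Rightarrow> real \<Rightarrow> real" where
  "flat_deriv n t = (if t > 0 then poly (bump_poly n) (1 / t) * exp (- (1 / t)) else 0)"

lemma poly_exp_tendsto_0: "((\<lambda>s. poly q s * exp (- s)) \<longlongrightarrow> (0 :: real)) at_top"
proof -
  have "((\<lambda>s. \<Sum>i\<le>degree q. coeff q i * (s ^ i / exp s)) \<longlongrightarrow> (\<Sum>i\<le>degree q. coeff q i * 0)) at_top"
    by (intro tendsto_sum tendsto_mult tendsto_const tendsto_power_div_exp_0)
  then show ?thesis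
    by (simp add: poly_altdef exp_minus divide_inverse sum_distrib_right mult.assoc)
qed

text \<open>Away from \<open>0\<close> the recursion for \<open>bump_poly\<close> is the product rule. At \<open>0\<close> the difference quotient
  is \<open>s * q s * exp (- s)\<close> with \<open>s = 1 / t\<close> and a polynomial \<open>q\<close>, and the exponential wins.\<close>

lemma flat_deriv_has_derivative:
  "(flat_deriv n has_real_derivative flat_deriv (Suc n) t) (at t)"
proof -
  consider "t > 0" | "t < 0" | "t = 0" by linarith
  then show ?thesis
  proof cases
    case 1
    have "((\<lambda>t. poly (bump_poly n) (1 / t) * exp (- (1 / t))) has_real_derivative
        flat_deriv (Suc n) t) (at t)"
      using 1 unfolding flat_deriv_def
      by (auto intro!: derivative_eq_intros simp: poly_monom field_simps power2_eq_square)
    then show ?thesis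
      by (rule has_field_derivative_transform_within_open[where S = "{0<..}"])
        (use 1 in \<open>auto simp: flat_deriv_def\<close>)
  next
    case 2
    have "((\<lambda>t. 0) has_real_derivative flat_deriv (Suc n) t) (at t)"
      using 2 by (simp add: flat_deriv_def)
    then show ?thesis
      by (rule has_field_derivative_transform_within_open[where S = "{..<0}"])
        (use 2 in \<open>auto simp: flat_deriv_def\<close>)
  next
    case 3
    have "((\<lambda>t. poly (pCons 0 (bump_poly n)) (inverse t) * exp (- inverse t)) \<longlongrightarrow> 0) (at_right 0)"
      by (rule filterlim_compose[OF poly_exp_tendsto_0 filterlim_inverse_at_top_right])
    then have "((\<lambda>t. flat_deriv n t / t) \<longlongrightarrow> 0) (at_right 0)"
      by (rule Lim_transform_eventually)
        (auto simp: eventually_at_right_field flat_deriv_def field_simps intro!: exI[of _ 1])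
    moreover have "((\<lambda>t. flat_deriv n t / t) \<longlongrightarrow> 0) (at_left 0)"
      by (rule tendsto_eventually)
        (auto simp: eventually_at_left_field flat_deriv_def intro!: exI[of _ "-1"])
    ultimately have "((\<lambda>t. flat_deriv n t / t) \<longlongrightarrow> 0) (at 0)"
      by (simp add: filterlim_at_split)
    with 3 show ?thesis
      by (simp add: has_field_derivative_iff flat_deriv_def)
  qed
qed

lemma flat_deriv_pos_iff: "flat_deriv 0 t > 0 \<longleftrightarrow> t > 0"
  by (simp add: flat_deriv_def)

lemma flat_deriv_nonneg: "flat_deriv 0 t \<ge> 0"
  by (simp add: flat_deriv_def)

lemma flat_deriv_zero_iff: "flat_deriv 0 t = 0 \<longleftrightarrow> t \<le> 0"
  by (simp add: flat_deriv_def)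

lemma smooth_on_flat:
  assumes "open S" "smooth_on S f"
  shows "smooth_on S (\<lambda>x. flat_deriv 0 (f x))"
  by (rule smooth_on_compose_real[where F = flat_deriv and T = UNIV, OF assms(1) _ _ assms(2)])
    (simp_all add: flat_deriv_has_derivative)

lemma smooth_on_inverse:
  fixes f :: "real ^ 'n \<Rightarrow> real"
  assumes "open S" "smooth_on S f" "\<And>x. x \<in> S \<Longrightarrow> f x > 0"
  shows "smooth_on S (\<lambda>x. inverse (f x))"
proof -
  \<comment> \<open>the successive derivatives of \<open>inverse\<close>\<close>
  define F :: "nat \<Rightarrow> real \<Rightarrow> real" where "F n t = (- 1) ^ n * fact n * inverse t ^ Suc n" for n t
  have "(F n has_real_derivative F (Suc n) t) (at t)" if "t \<in> {0<..}" for n t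
    unfolding F_def
    by (rule DERIV_cong[OF DERIV_cmult[OF DERIV_power_Suc[OF DERIV_inverse]]])
      (use that in \<open>auto simp: algebra_simps\<close>)
  then have "smooth_on S (\<lambda>x. F 0 (f x))"
    by (rule smooth_on_compose_real[where F = F and T = "{0<..}", OF assms(1) _ _ assms(2)])
      (use assms(3) in auto)
  then show ?thesis by (simp add: F_def divide_inverse)
qed

lemma smooth_on_norm_squared_diff: "smooth_on S (\<lambda>x :: real ^ 'n. (norm (x - c))\<^sup>2)"
proof -
  have "(norm (x - c))\<^sup>2 = (\<Sum>i\<in>UNIV. (x $ i - c $ i) * (x $ i - c $ i))" for x :: "real ^ 'n"
    by (simp add: power2_norm_eq_inner inner_vec_def)
  then have eq: "(\<lambda>x :: real ^ 'n. (norm (x - c))\<^sup>2) = (\<lambda>x. \<Sum>i\<in>UNIV. (x $ i - c $ i) * (x $ i - c $ i))"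
    by (rule ext)
  have "smooth_on UNIV (\<lambda>x :: real ^ 'n. \<Sum>i\<in>UNIV. (x $ i - c $ i) * (x $ i - c $ i))"
    by (intro smooth_on_sum smooth_on_mult smooth_on_diff smooth_on_nth smooth_on_const open_UNIV)
  then show ?thesis unfolding eq by (rule smooth_on_subset) simp
qed

text \<open>Finitely many balls inside \<open>U\<close> cover \<open>K\<close>. The sum \<open>\<psi>\<close> of flat functions of \<open>r\<^sup>2 - |x - c|\<^sup>2\<close> vanishes
  off these balls and has a positive minimum \<open>\<delta>\<close> on \<open>K\<close>. With \<open>g\<close> the flat function, the quotient
  \<open>g \<psi> / (g \<psi> + g (\<delta> - \<psi>))\<close> is smooth since \<open>\<psi>\<close> and \<open>\<delta> - \<psi>\<close> are never both nonpositive; it is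
  \<open>1\<close> where \<open>\<psi> \<ge> \<delta>\<close> and \<open>0\<close> where \<open>\<psi> = 0\<close>.\<close>

lemma smooth_cutoff:
  fixes K U :: "(real ^ 'n) set"
  assumes "compact K" "open U" "K \<subseteq> U"
  obtains \<eta> L where "smooth_on UNIV \<eta>" "compact L" "L \<subseteq> U"
    "\<And>x. x \<in> K \<Longrightarrow> \<eta> x = (1 :: real)" "\<And>x. x \<notin> L \<Longrightarrow> \<eta> x = 0"
proof (cases "K = {}")
  case True
  then show ?thesis using that[of "\<lambda>x. 0" "{}"] by (simp add: smooth_on_const)
next
  case False
  have "\<forall>c\<in>K. \<exists>r>0. cball c r \<subseteq> U"
    using assms(2,3) unfolding open_contains_cball by blast
  then obtain r where r: "\<And>c. c \<in> K \<Longrightarrow> r c > 0 \<and> cball c (r c) \<subseteq> U"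
    by (auto dest!: bchoice)
  have "K \<subseteq> (\<Union>c\<in>K. ball c (r c))"
  proof
    fix x assume x: "x \<in> K"
    then have "x \<in> ball x (r x)" using r by simp
    with x show "x \<in> (\<Union>c\<in>K. ball c (r c))" by (rule UN_I)
  qed
  then obtain F where F: "F \<subseteq> K" "finite F" "K \<subseteq> (\<Union>c\<in>F. ball c (r c))"
    by (rule compactE_image[OF assms(1) open_ball])
  define \<psi> where "\<psi> x = (\<Sum>c\<in>F. flat_deriv 0 ((r c)\<^sup>2 - (norm (x - c))\<^sup>2))" for x
  have pos_iff: "(r c)\<^sup>2 - (norm (x - c))\<^sup>2 > 0 \<longleftrightarrow> x \<in> ball c (r c)" if "c \<in> F" for c x
  proof -
    have "r c > 0" using r[of c] that F(1) by blast
    then show ?thesis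
      by (auto simp: dist_norm norm_minus_commute intro: power2_less_imp_less power_strict_mono)
  qed
  have smooth: "smooth_on UNIV \<psi>"
    unfolding \<psi>_def
    by (intro smooth_on_sum smooth_on_flat smooth_on_diff smooth_on_const
        smooth_on_norm_squared_diff open_UNIV)
  have nonneg: "\<psi> x \<ge> 0" for x
    unfolding \<psi>_def by (intro sum_nonneg flat_deriv_nonneg)
  have pos: "\<psi> x > 0" if "x \<in> K" for x
  proof -
    from that F(3) obtain c where "c \<in> F" "x \<in> ball c (r c)" by blast
    then show ?thesis unfolding \<psi>_def
      using F(2) pos_iff by (intro sum_pos2[of F c]) (auto simp: flat_deriv_pos_iff flat_deriv_nonneg)
  qed
  have "continuous_on K \<psi>"
    using smooth_on_imp_continuous_on[OF smooth] by (rule continuous_on_subset) simp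
  then obtain x0 where x0: "x0 \<in> K" "\<And>x. x \<in> K \<Longrightarrow> \<psi> x0 \<le> \<psi> x"
    using continuous_attains_inf[OF assms(1) False] by blast
  define N D where "N x = flat_deriv 0 (\<psi> x)"
    and "D x = flat_deriv 0 (\<psi> x) + flat_deriv 0 (\<psi> x0 - \<psi> x)" for x
  have "D x > 0" for x
    using pos[OF x0(1)] flat_deriv_nonneg[of "\<psi> x"] flat_deriv_nonneg[of "\<psi> x0 - \<psi> x"]
      flat_deriv_pos_iff[of "\<psi> x"] flat_deriv_pos_iff[of "\<psi> x0 - \<psi> x"]
    unfolding D_def by linarith
  then have "smooth_on UNIV (\<lambda>x. N x * inverse (D x))"
    unfolding N_def D_def
    by (intro smooth_on_mult smooth_on_inverse smooth_on_add smooth_on_flat smooth_on_diff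
        smooth_on_const smooth open_UNIV)
  moreover have "compact (\<Union>c\<in>F. cball c (r c))" "(\<Union>c\<in>F. cball c (r c)) \<subseteq> U"
    using F r by (auto intro!: compact_UN)
  moreover have "N x * inverse (D x) = 1" if "x \<in> K" for x
    using pos[OF that] x0(2)[OF that] flat_deriv_zero_iff[of "\<psi> x0 - \<psi> x"]
      flat_deriv_pos_iff[of "\<psi> x"] by (simp add: N_def D_def)
  moreover have "N x * inverse (D x) = 0" if "x \<notin> (\<Union>c\<in>F. cball c (r c))" for x
  proof -
    have "\<psi> x = 0" unfolding \<psi>_def
    proof (intro sum.neutral ballI)
      fix c assume c: "c \<in> F"
      with that have "x \<notin> ball c (r c)" by auto
      with pos_iff[OF c] have "\<not> (r c)\<^sup>2 - (norm (x - c))\<^sup>2 > 0" by blast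
      then show "flat_deriv 0 ((r c)\<^sup>2 - (norm (x - c))\<^sup>2) = 0"
        by (simp add: flat_deriv_zero_iff)
    qed
    then show ?thesis by (simp add: N_def flat_deriv_def)
  qed
  ultimately show ?thesis by (rule that)
qed

text \<open>The cutoffs belong to a compact exhaustion. They become \<open>1\<close> on a whole neighbourhood of each
  compact set, so that multiplying by them eventually leaves all derivatives there unchanged. The
  entry at index \<open>0\<close> is the zero function with empty support: it is the choice that is always
  available in the diagonal argument.\<close>

lemma cutoff_exhaustion:
  fixes \<Omega> :: "(real ^ 'n) set"
  assumes "open \<Omega>"
  obtains \<eta> L where "\<And>n. smooth_on UNIV (\<eta> n)" "\<And>n. compact (L n)" "\<And>n. L n \<subseteq> \<Omega>" "L 0 = {}"
    "\<And>n x. x \<notin> L n \<Longrightarrow> \<eta> n x = (0 :: real)"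
    "\<And>K. compact K \<Longrightarrow> K \<subseteq> \<Omega> \<Longrightarrow>
       \<exists>U. open U \<and> K \<subseteq> U \<and> (\<forall>\<^sub>F n :: nat in sequentially. \<forall>x\<in>U. \<eta> n x = 1)"
proof -
  obtain C where C: "\<And>n. compact (C n)" "\<And>n. C n \<subseteq> \<Omega>" "\<And>n. C n \<subseteq> interior (C (Suc n))"
    "\<And>K. compact K \<Longrightarrow> K \<subseteq> \<Omega> \<Longrightarrow> \<exists>N. \<forall>n\<ge>N. K \<subseteq> C n"
    using open_Union_compact_subsets[OF assms] by metis
  have "\<exists>p. smooth_on UNIV (fst p) \<and> compact (snd p) \<and> snd p \<subseteq> \<Omega> \<and>
      (\<forall>x\<in>C n. fst p x = (1 :: real)) \<and> (\<forall>x. x \<notin> snd p \<longrightarrow> fst p x = 0)" for n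
    using smooth_cutoff[OF C(1) assms C(2), of n] by (metis fst_conv snd_conv)
  then obtain p where p: "\<And>n. smooth_on UNIV (fst (p n)) \<and> compact (snd (p n)) \<and> snd (p n) \<subseteq> \<Omega> \<and>
      (\<forall>x\<in>C n. fst (p n) x = (1 :: real)) \<and> (\<forall>x. x \<notin> snd (p n) \<longrightarrow> fst (p n) x = 0)"
    by metis
  define \<eta> where "\<eta> = case_nat (\<lambda>x. 0) (\<lambda>n. fst (p n))"
  define L where "L = case_nat {} (\<lambda>n. snd (p n))"
  show ?thesis
  proof (rule that[of \<eta> L])
    fix K assume "compact K" "K \<subseteq> \<Omega>"
    then obtain N where N: "\<And>n. n \<ge> N \<Longrightarrow> K \<subseteq> C n" using C(4) by metis
    have mono: "C m \<subseteq> C n" if "m \<le> n" for m n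
      using that by (rule lift_Suc_mono_le[of C, rotated]) (use C(3) interior_subset in blast)
    \<comment> \<open>one step of the exhaustion turns \<open>K\<close> into a neighbourhood, a second one accounts for the shift by the zero function\<close>
    have "\<eta> n x = 1" if n: "n \<ge> Suc (Suc N)" and x: "x \<in> interior (C (Suc N))" for n x
    proof -
      obtain m where m: "n = Suc m" "m \<ge> Suc N" using n by (cases n) auto
      then have "x \<in> C m" using x interior_subset mono by blast
      then show ?thesis using p by (simp add: \<eta>_def m)
    qed
    then show "\<exists>U. open U \<and> K \<subseteq> U \<and> (\<forall>\<^sub>F n in sequentially. \<forall>x\<in>U. \<eta> n x = 1)"
      using N[of N] C(3)[of N] unfolding eventually_sequentially
      by (intro exI[of _ "interior (C (Suc N))"]) blast
  qed (use p in \<open>auto simp: \<eta>_def L_def smooth_on_const split: nat.splits\<close>)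
qed

section \<open>Nets and compactly supported generalized points\<close>

lemma eventually_at_right_unit_interval: "\<forall>\<^sub>F \<epsilon> in at_right (0 :: real). \<epsilon> \<in> {0<..1}"
  by (auto simp: eventually_at_right_field intro!: exI[of _ 1])

lemma bigo_iff_bound: "f \<in> O[F](g) \<longleftrightarrow> (\<exists>c. \<forall>\<^sub>F x in F. norm (f x) \<le> c * norm (g x))"
  by (rule iffI, (elim landau_o.bigE, blast), (elim exE, erule bigoI))

lemma bigo_at_right_0_iff:
  assumes "\<And>\<epsilon> :: real. \<epsilon> \<in> {0<..1} \<Longrightarrow> g \<epsilon> \<ge> 0"
  shows "f \<in> O[at_right 0](g) \<longleftrightarrow> (\<exists>c. \<forall>\<^sub>F \<epsilon> in at_right 0. norm (f \<epsilon>) \<le> c * (g \<epsilon> :: real))"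
proof -
  have "(\<forall>\<^sub>F \<epsilon> in at_right 0. norm (f \<epsilon>) \<le> c * norm (g \<epsilon>)) \<longleftrightarrow>
      (\<forall>\<^sub>F \<epsilon> in at_right 0. norm (f \<epsilon>) \<le> c * g \<epsilon>)" for c
    by (rule eventually_subst, rule eventually_mono[OF eventually_at_right_unit_interval])
      (use assms in simp)
  then show ?thesis by (simp add: bigo_iff_bound)
qed

lemma moderate_nets_iff:
  "x \<in> moderate_nets \<longleftrightarrow> (\<exists>N c. \<forall>\<^sub>F \<epsilon> in at_right 0. norm (x \<epsilon>) \<le> c * (1 / \<epsilon> ^ N))"
  unfolding moderate_nets_def mem_Collect_eq
  by (intro ex_cong1) (subst bigo_at_right_0_iff, auto)

definition negligible_net :: "(real \<Rightarrow> 'a::real_normed_vector) \<Rightarrow> bool" where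
  "negligible_net x \<longleftrightarrow> (\<forall>m. (\<lambda>\<epsilon>. norm (x \<epsilon>)) \<in> O[at_right 0](\<lambda>\<epsilon>. \<epsilon> ^ m))"

lemma negligible_net_iff:
  "negligible_net x \<longleftrightarrow> (\<forall>m. \<exists>c. \<forall>\<^sub>F \<epsilon> in at_right 0. norm (x \<epsilon>) \<le> c * \<epsilon> ^ m)"
  unfolding negligible_net_def by (intro all_cong1) (subst bigo_at_right_0_iff, auto)

lemma net_rel_iff:
  "(x, y) \<in> net_rel \<longleftrightarrow>
     x \<in> moderate_nets \<and> y \<in> moderate_nets \<and> negligible_net (\<lambda>\<epsilon>. x \<epsilon> - y \<epsilon>)"
  by (simp add: net_rel_def negligible_net_def)

lemma negligible_net_add:
  assumes "negligible_net x" "negligible_net y"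
  shows "negligible_net (\<lambda>\<epsilon>. x \<epsilon> + y \<epsilon>)"
  unfolding negligible_net_def
proof
  fix m
  have "(\<lambda>\<epsilon>. norm (x \<epsilon>) + norm (y \<epsilon>)) \<in> O[at_right 0](\<lambda>\<epsilon>. \<epsilon> ^ m)"
    using assms unfolding negligible_net_def by (intro sum_in_bigo) auto
  moreover have "(\<lambda>\<epsilon>. norm (x \<epsilon> + y \<epsilon>)) \<in> O[at_right 0](\<lambda>\<epsilon>. norm (x \<epsilon>) + norm (y \<epsilon>))"
    by (rule bigoI[of _ 1]) (simp add: norm_triangle_ineq)
  ultimately show "(\<lambda>\<epsilon>. norm (x \<epsilon> + y \<epsilon>)) \<in> O[at_right 0](\<lambda>\<epsilon>. \<epsilon> ^ m)"
    by (rule landau_o.big_trans[rotated])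
qed

lemma negligible_net_minus: "negligible_net (\<lambda>\<epsilon>. - x \<epsilon>) = negligible_net x"
  by (simp add: negligible_net_def)

lemma equiv_net_rel:
  "equiv moderate_nets (net_rel :: ((real \<Rightarrow> 'a::real_normed_vector) \<times> (real \<Rightarrow> 'a)) set)"
  (is "equiv ?M ?R")
proof (rule equivI)
  show "refl_on ?M ?R"
    by (rule refl_onI) (simp add: net_rel_iff negligible_net_def)
  show "sym ?R"
  proof (rule symI)
    fix x y :: "real \<Rightarrow> 'a"
    assume "(x, y) \<in> net_rel"
    then show "(y, x) \<in> net_rel"
      using negligible_net_minus[of "\<lambda>\<epsilon>. x \<epsilon> - y \<epsilon>"] by (simp add: net_rel_iff)
  qed
  show "trans ?R"
  proof (rule transI)
    fix x y z :: "real \<Rightarrow> 'a"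
    assume "(x, y) \<in> net_rel" "(y, z) \<in> net_rel"
    then show "(x, z) \<in> net_rel"
      using negligible_net_add[of "\<lambda>\<epsilon>. x \<epsilon> - y \<epsilon>" "\<lambda>\<epsilon>. y \<epsilon> - z \<epsilon>"] by (simp add: net_rel_iff)
  qed
  show "?R \<subseteq> ?M \<times> ?M"
    by (rule subrelI) (simp add: net_rel_iff)
qed

lemma net_class_eq_iff:
  "x \<in> moderate_nets \<Longrightarrow> y \<in> moderate_nets \<Longrightarrow>
     net_class x = net_class y \<longleftrightarrow> negligible_net (\<lambda>\<epsilon>. x \<epsilon> - y \<epsilon>)"
  unfolding net_class_def using eq_equiv_class_iff[OF equiv_net_rel, of x y] by (simp add: net_rel_iff)

lemma net_class_self: "x \<in> moderate_nets \<Longrightarrow> x \<in> net_class x"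
  unfolding net_class_def by (rule equiv_class_self[OF equiv_net_rel])

lemma net_class_in_gen_space: "x \<in> moderate_nets \<Longrightarrow> net_class x \<in> gen_space"
  unfolding net_class_def gen_space_def by (rule quotientI)

lemma moderate_nets_mono:
  assumes "y \<in> moderate_nets" "\<forall>\<^sub>F \<epsilon> in at_right 0. norm (x \<epsilon>) \<le> norm (y \<epsilon>)"
  shows "x \<in> moderate_nets"
proof -
  obtain N c where "\<forall>\<^sub>F \<epsilon> in at_right 0. norm (y \<epsilon>) \<le> c * (1 / \<epsilon> ^ N)"
    using assms(1) unfolding moderate_nets_iff by blast
  with assms(2) have "\<forall>\<^sub>F \<epsilon> in at_right 0. norm (x \<epsilon>) \<le> c * (1 / \<epsilon> ^ N)"
    by eventually_elim linarith
  then show ?thesis unfolding moderate_nets_iff by blast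
qed

lemma moderate_nets_cong:
  assumes "\<forall>\<^sub>F \<epsilon> in at_right 0. x \<epsilon> = y \<epsilon>"
  shows "x \<in> moderate_nets \<longleftrightarrow> y \<in> moderate_nets"
proof -
  have "\<forall>\<^sub>F \<epsilon> in at_right 0. norm (x \<epsilon>) \<le> norm (y \<epsilon>)" "\<forall>\<^sub>F \<epsilon> in at_right 0. norm (y \<epsilon>) \<le> norm (x \<epsilon>)"
    by (rule eventually_mono[OF assms], simp)+
  then show ?thesis using moderate_nets_mono by blast
qed

lemma net_class_cong:
  assumes "\<forall>\<^sub>F \<epsilon> in at_right 0. x \<epsilon> = y \<epsilon>"
  shows "net_class x = net_class y"
proof -
  have "((x, z) \<in> net_rel) = ((y, z) \<in> net_rel)" for z
  proof -
    have "(\<forall>\<^sub>F \<epsilon> in at_right 0. norm (x \<epsilon> - z \<epsilon>) \<le> c * \<epsilon> ^ m) =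
        (\<forall>\<^sub>F \<epsilon> in at_right 0. norm (y \<epsilon> - z \<epsilon>) \<le> c * \<epsilon> ^ m)" for c m
      by (rule eventually_subst[OF eventually_mono[OF assms]]) simp
    then show ?thesis
      using moderate_nets_cong[OF assms] by (simp add: net_rel_iff negligible_net_iff)
  qed
  then show ?thesis by (simp add: net_class_def set_eq_iff)
qed

lemma compact_thickening:
  fixes K :: "'a::euclidean_space set"
  assumes "compact K" "open \<Omega>" "K \<subseteq> \<Omega>"
  obtains e K' where "e > 0" "compact K'" "K' \<subseteq> \<Omega>" "\<forall>x\<in>K. cball x e \<subseteq> K'"
proof -
  obtain e where "e > 0" "(\<Union>x\<in>K. cball x e) \<subseteq> \<Omega>"
    using compact_subset_open_imp_cball_epsilon_subset[OF assms] .
  then show ?thesis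
    using that[of e "\<Union>x\<in>K. cball x e"] compact_minkowski_sum_cball[OF assms(1), of e] by blast
qed

lemma negligible_net_eventually_small:
  assumes "negligible_net x" "e > 0"
  shows "\<forall>\<^sub>F \<epsilon> in at_right 0. norm (x \<epsilon>) \<le> e"
proof -
  obtain c where c: "\<forall>\<^sub>F \<epsilon> in at_right 0. norm (x \<epsilon>) \<le> c * \<epsilon> ^ 1"
    using assms(1) unfolding negligible_net_iff by blast
  have "((\<lambda>\<epsilon>. c * \<epsilon> ^ 1) \<longlongrightarrow> c * 0 ^ 1) (at_right 0)"
    by (intro tendsto_intros)
  then have "\<forall>\<^sub>F \<epsilon> in at_right 0. c * \<epsilon> ^ 1 < e"
    using assms(2) by (intro order_tendstoD) auto
  with c show ?thesis by eventually_elim linarith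
qed

text \<open>Two representatives of the same point differ by a net that tends to \<open>0\<close>, so both end up in a small
  ball around a point of the compact set that carries one of them; balls are convex. The segment between the
  representatives is what the mean value theorem needs.\<close>

lemma compact_gen_pointsE:
  assumes "open \<Omega>" "p \<in> compact_gen_points \<Omega>"
  obtains K where "compact K" "K \<subseteq> \<Omega>"
    "\<And>x y. x \<in> p \<Longrightarrow> y \<in> p \<Longrightarrow> \<forall>\<^sub>F \<epsilon> in at_right 0. closed_segment (x \<epsilon>) (y \<epsilon>) \<subseteq> K"
proof -
  obtain z K0 where z: "p = net_class z" "compact K0" "K0 \<subseteq> \<Omega>" "\<forall>\<^sub>F \<epsilon> in at_right 0. z \<epsilon> \<in> K0"
    using assms(2) unfolding compact_gen_points_def by blast
  obtain e K where K: "e > 0" "compact K" "K \<subseteq> \<Omega>" "\<forall>x\<in>K0. cball x e \<subseteq> K"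
    by (rule compact_thickening[OF z(2) assms(1) z(3)])
  have near: "\<forall>\<^sub>F \<epsilon> in at_right 0. x \<epsilon> \<in> cball (z \<epsilon>) e" if "x \<in> p" for x
    using negligible_net_eventually_small[of "\<lambda>\<epsilon>. z \<epsilon> - x \<epsilon>", OF _ K(1)] that
    by (simp add: z(1) net_class_def net_rel_iff dist_norm)
  show ?thesis
  proof (rule that[OF K(2,3)])
    fix x y assume "x \<in> p" "y \<in> p"
    from near[OF this(1)] near[OF this(2)] z(4)
    show "\<forall>\<^sub>F \<epsilon> in at_right 0. closed_segment (x \<epsilon>) (y \<epsilon>) \<subseteq> K"
    proof eventually_elim
      case (elim \<epsilon>)
      then have "closed_segment (x \<epsilon>) (y \<epsilon>) \<subseteq> cball (z \<epsilon>) e"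
        by (intro closed_segment_subset convex_cball)
      with elim K(4) show ?case by blast
    qed
  qed
qed

lemma compact_gen_point_eventually_in_compact:
  assumes "open \<Omega>" "p \<in> compact_gen_points \<Omega>"
  obtains K where "compact K" "K \<subseteq> \<Omega>" "\<And>x. x \<in> p \<Longrightarrow> \<forall>\<^sub>F \<epsilon> in at_right 0. x \<epsilon> \<in> K"
proof -
  obtain K where K: "compact K" "K \<subseteq> \<Omega>"
    and seg: "\<And>x y. x \<in> p \<Longrightarrow> y \<in> p \<Longrightarrow> \<forall>\<^sub>F \<epsilon> in at_right 0. closed_segment (x \<epsilon>) (y \<epsilon>) \<subseteq> K"
    using compact_gen_pointsE[OF assms] by metis
  have "\<forall>\<^sub>F \<epsilon> in at_right 0. x \<epsilon> \<in> K" if "x \<in> p" for x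
    using seg[OF that that] by simp
  with K show ?thesis by (rule that)
qed

lemma compact_gen_point_rel:
  assumes "p \<in> compact_gen_points \<Omega>" "x \<in> p" "y \<in> p"
  shows "(x, y) \<in> net_rel"
proof -
  obtain z where "(z, x) \<in> net_rel" "(z, y) \<in> net_rel"
    using assms unfolding compact_gen_points_def net_class_def by blast
  then show ?thesis
    using equiv_net_rel unfolding equiv_def by (meson symD transD)
qed

lemma compact_gen_points_subset_gen_space: "compact_gen_points \<Omega> \<subseteq> gen_space"
  by (auto simp: compact_gen_points_def intro: net_class_in_gen_space)

lemma compact_gen_points_nonempty: "p \<in> compact_gen_points \<Omega> \<Longrightarrow> p \<noteq> {}"
  by (auto simp: compact_gen_points_def dest: net_class_self)

text \<open>The supply of test points: an arbitrary net in a compact set represents a compactly supported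
  point. Choosing the net adversarially turns statements about points into uniform ones.\<close>

lemma net_in_compact:
  assumes "compact K" "K \<subseteq> \<Omega>" "\<forall>\<epsilon>. x \<epsilon> \<in> K"
  shows "net_class x \<in> compact_gen_points \<Omega>" "x \<in> net_class x"
proof -
  obtain B where B: "\<And>y. y \<in> K \<Longrightarrow> norm y \<le> B"
    using assms(1) compact_imp_bounded bounded_iff by metis
  then have "x \<in> moderate_nets"
    unfolding moderate_nets_iff using assms(3) by (intro exI[of _ 0] exI[of _ B]) auto
  then show "net_class x \<in> compact_gen_points \<Omega>" "x \<in> net_class x"
    using assms net_class_self by (auto simp: compact_gen_points_def intro!: exI[of _ x] exI[of _ K])
qed

section \<open>Uniform bounds from point values and interpolation\<close>

text \<open>A continuous function attains its maximum on a compact set, for each \<open>\<epsilon>\<close> separately. A bound along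
  the net of maximizers is therefore a uniform bound.\<close>

lemma maximizing_net:
  fixes h :: "'e \<Rightarrow> 'a::topological_space \<Rightarrow> real"
  assumes "compact K" "K \<noteq> {}" "\<forall>\<^sub>F \<epsilon> in F. continuous_on K (h \<epsilon>)"
  obtains y where "\<forall>\<epsilon>. y \<epsilon> \<in> K" "\<forall>\<^sub>F \<epsilon> in F. \<forall>x\<in>K. \<bar>h \<epsilon> x\<bar> \<le> \<bar>h \<epsilon> (y \<epsilon>)\<bar>"
proof -
  have "\<exists>y\<in>K. continuous_on K (h \<epsilon>) \<longrightarrow> (\<forall>x\<in>K. \<bar>h \<epsilon> x\<bar> \<le> \<bar>h \<epsilon> y\<bar>)" for \<epsilon>
  proof (cases "continuous_on K (h \<epsilon>)")
    case True
    then have "continuous_on K (\<lambda>x. \<bar>h \<epsilon> x\<bar>)" by (rule continuous_on_rabs)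
    from continuous_attains_sup[OF assms(1,2) this] show ?thesis by blast
  qed (use assms(2) in blast)
  then obtain y where y: "\<And>\<epsilon>. y \<epsilon> \<in> K"
    "\<And>\<epsilon>. continuous_on K (h \<epsilon>) \<Longrightarrow> (\<forall>x\<in>K. \<bar>h \<epsilon> x\<bar> \<le> \<bar>h \<epsilon> (y \<epsilon>)\<bar>)" by metis
  from assms(3) have "\<forall>\<^sub>F \<epsilon> in F. \<forall>x\<in>K. \<bar>h \<epsilon> x\<bar> \<le> \<bar>h \<epsilon> (y \<epsilon>)\<bar>"
    by (rule eventually_mono) (rule y(2))
  with y(1) show ?thesis using that by blast
qed

lemma SUP_abs_bigo_iff:
  fixes h :: "real \<Rightarrow> 'a::topological_space \<Rightarrow> real" and g :: "real \<Rightarrow> real"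
  assumes "compact K" "K \<noteq> {}" "\<forall>\<^sub>F \<epsilon> in at_right 0. continuous_on K (h \<epsilon>)"
    and "\<And>\<epsilon>. \<epsilon> \<in> {0<..1} \<Longrightarrow> g \<epsilon> \<ge> 0"
  shows "(\<lambda>\<epsilon>. SUP x\<in>K. \<bar>h \<epsilon> x\<bar>) \<in> O[at_right 0](g) \<longleftrightarrow>
    (\<exists>c. \<forall>\<^sub>F \<epsilon> in at_right 0. \<forall>x\<in>K. \<bar>h \<epsilon> x\<bar> \<le> c * g \<epsilon>)"
proof -
  obtain y where y: "\<forall>\<epsilon>. y \<epsilon> \<in> K"
    "\<forall>\<^sub>F \<epsilon> in at_right 0. \<forall>x\<in>K. \<bar>h \<epsilon> x\<bar> \<le> \<bar>h \<epsilon> (y \<epsilon>)\<bar>"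
    by (rule maximizing_net[OF assms(1-3)])
  have "(norm (SUP x\<in>K. \<bar>h \<epsilon> x\<bar>) \<le> c * g \<epsilon>) = (\<forall>x\<in>K. \<bar>h \<epsilon> x\<bar> \<le> c * g \<epsilon>)"
    if max: "\<forall>x\<in>K. \<bar>h \<epsilon> x\<bar> \<le> \<bar>h \<epsilon> (y \<epsilon>)\<bar>" for \<epsilon> c
  proof -
    have "(SUP x\<in>K. \<bar>h \<epsilon> x\<bar>) = \<bar>h \<epsilon> (y \<epsilon>)\<bar>"
      by (rule cSup_eq_maximum, rule imageI, rule y(1)[rule_format]) (use max in auto)
    moreover have "(\<forall>x\<in>K. \<bar>h \<epsilon> x\<bar> \<le> c * g \<epsilon>) \<longleftrightarrow> \<bar>h \<epsilon> (y \<epsilon>)\<bar> \<le> c * g \<epsilon>"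
      using max y(1) by (meson order_trans)
    ultimately show ?thesis by simp
  qed
  then have "(\<forall>\<^sub>F \<epsilon> in at_right 0. norm (SUP x\<in>K. \<bar>h \<epsilon> x\<bar>) \<le> c * g \<epsilon>) \<longleftrightarrow>
      (\<forall>\<^sub>F \<epsilon> in at_right 0. \<forall>x\<in>K. \<bar>h \<epsilon> x\<bar> \<le> c * g \<epsilon>)" for c
    by (rule eventually_subst[OF eventually_mono[OF y(2)]])
  then show ?thesis by (simp only: bigo_at_right_0_iff[OF assms(4)])
qed

text \<open>The growth conditions of the Colombeau algebra for a single derivative, with the supremum
  replaced by a uniform bound.\<close>

definition locally_moderate :: "(real ^ 'd::finite) set \<Rightarrow> (real \<Rightarrow> real ^ 'd \<Rightarrow> real) \<Rightarrow> bool" where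
  "locally_moderate \<Omega> h \<longleftrightarrow> (\<forall>K. compact K \<and> K \<subseteq> \<Omega> \<longrightarrow>
     (\<exists>N c. \<forall>\<^sub>F \<epsilon> in at_right 0. \<forall>x\<in>K. \<bar>h \<epsilon> x\<bar> \<le> c * (1 / \<epsilon> ^ N)))"

definition locally_negligible :: "(real ^ 'd::finite) set \<Rightarrow> (real \<Rightarrow> real ^ 'd \<Rightarrow> real) \<Rightarrow> bool" where
  "locally_negligible \<Omega> h \<longleftrightarrow> (\<forall>K. compact K \<and> K \<subseteq> \<Omega> \<longrightarrow>
     (\<forall>m. \<exists>c. \<forall>\<^sub>F \<epsilon> in at_right 0. \<forall>x\<in>K. \<bar>h \<epsilon> x\<bar> \<le> c * \<epsilon> ^ m))"

lemma eventually_continuous_on: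
  fixes u :: "real \<Rightarrow> real ^ 'd \<Rightarrow> real"
  assumes "\<And>\<epsilon>. \<epsilon> \<in> {0<..1} \<Longrightarrow> smooth_on \<Omega> (u \<epsilon>)" "K \<subseteq> \<Omega>"
  shows "\<forall>\<^sub>F \<epsilon> in at_right 0. continuous_on K (multi_partial \<alpha> (u \<epsilon>))"
  using eventually_at_right_unit_interval
proof eventually_elim
  case (elim \<epsilon>)
  show ?case
    by (rule continuous_on_subset[OF _ assms(2)])
      (intro smooth_on_imp_continuous_on smooth_on_multi_partial assms(1) elim)
qed

lemma colombeau_moderate_iff:
  "u \<in> colombeau_moderate \<Omega> \<longleftrightarrow> (\<forall>\<epsilon>\<in>{0<..1}. smooth_on \<Omega> (u \<epsilon>)) \<and>
     (\<forall>\<alpha>. locally_moderate \<Omega> (\<lambda>\<epsilon>. multi_partial \<alpha> (u \<epsilon>)))"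
proof (cases "\<forall>\<epsilon>\<in>{0<..1}. smooth_on \<Omega> (u \<epsilon>)")
  case True
  have eq: "(\<lambda>\<epsilon>. SUP x\<in>K. \<bar>multi_partial \<alpha> (u \<epsilon>) x\<bar>) \<in> O[at_right 0](\<lambda>\<epsilon>. 1 / \<epsilon> ^ N) \<longleftrightarrow>
      (\<exists>c. \<forall>\<^sub>F \<epsilon> in at_right 0. \<forall>x\<in>K. \<bar>multi_partial \<alpha> (u \<epsilon>) x\<bar> \<le> c * (1 / \<epsilon> ^ N))"
    if "compact K" "K \<noteq> {}" "K \<subseteq> \<Omega>" for K \<alpha> N
    using that True eventually_continuous_on[of \<Omega> u K \<alpha>] by (intro SUP_abs_bigo_iff) auto
  have "(compact K \<and> K \<noteq> {} \<and> K \<subseteq> \<Omega> \<longrightarrow> (\<exists>N. (\<lambda>\<epsilon>. SUP x\<in>K. \<bar>multi_partial \<alpha> (u \<epsilon>) x\<bar>) \<in> O[at_right 0](\<lambda>\<epsilon>. 1 / \<epsilon> ^ N))) \<longleftrightarrow>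
      (compact K \<and> K \<subseteq> \<Omega> \<longrightarrow> (\<exists>N c. \<forall>\<^sub>F \<epsilon> in at_right 0. \<forall>x\<in>K. \<bar>multi_partial \<alpha> (u \<epsilon>) x\<bar> \<le> c * (1 / \<epsilon> ^ N)))" for K \<alpha>
    using eq[of K \<alpha>] by (cases "K = {}") auto
  with True show ?thesis
    unfolding colombeau_moderate_def locally_moderate_def mem_Collect_eq by (simp only:) blast
qed (unfold colombeau_moderate_def mem_Collect_eq, blast)

lemma colombeau_negligible_iff:
  "u \<in> colombeau_negligible \<Omega> \<longleftrightarrow> (\<forall>\<epsilon>\<in>{0<..1}. smooth_on \<Omega> (u \<epsilon>)) \<and>
     (\<forall>\<alpha>. locally_negligible \<Omega> (\<lambda>\<epsilon>. multi_partial \<alpha> (u \<epsilon>)))"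
proof (cases "\<forall>\<epsilon>\<in>{0<..1}. smooth_on \<Omega> (u \<epsilon>)")
  case True
  have eq: "(\<lambda>\<epsilon>. SUP x\<in>K. \<bar>multi_partial \<alpha> (u \<epsilon>) x\<bar>) \<in> O[at_right 0](\<lambda>\<epsilon>. \<epsilon> ^ m) \<longleftrightarrow>
      (\<exists>c. \<forall>\<^sub>F \<epsilon> in at_right 0. \<forall>x\<in>K. \<bar>multi_partial \<alpha> (u \<epsilon>) x\<bar> \<le> c * \<epsilon> ^ m)"
    if "compact K" "K \<noteq> {}" "K \<subseteq> \<Omega>" for K \<alpha> m
    using that True eventually_continuous_on[of \<Omega> u K \<alpha>] by (intro SUP_abs_bigo_iff) auto
  have "(compact K \<and> K \<noteq> {} \<and> K \<subseteq> \<Omega> \<longrightarrow> (\<forall>m. (\<lambda>\<epsilon>. SUP x\<in>K. \<bar>multi_partial \<alpha> (u \<epsilon>) x\<bar>) \<in> O[at_right 0](\<lambda>\<epsilon>. \<epsilon> ^ m))) \<longleftrightarrow>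
      (compact K \<and> K \<subseteq> \<Omega> \<longrightarrow> (\<forall>m. \<exists>c. \<forall>\<^sub>F \<epsilon> in at_right 0. \<forall>x\<in>K. \<bar>multi_partial \<alpha> (u \<epsilon>) x\<bar> \<le> c * \<epsilon> ^ m))" for K \<alpha>
    using eq[of K \<alpha>] by (cases "K = {}") auto
  with True show ?thesis
    unfolding colombeau_negligible_def locally_negligible_def mem_Collect_eq by (simp only:) blast
qed (unfold colombeau_negligible_def mem_Collect_eq, blast)

lemma locally_moderate_diff:
  assumes "locally_moderate \<Omega> g" "locally_moderate \<Omega> h"
  shows "locally_moderate \<Omega> (\<lambda>\<epsilon> x. g \<epsilon> x - h \<epsilon> x)"
  unfolding locally_moderate_def
proof (intro allI impI, elim conjE)
  fix K assume K: "compact K" "K \<subseteq> \<Omega>"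
  obtain N c where g: "\<forall>\<^sub>F \<epsilon> in at_right 0. \<forall>x\<in>K. \<bar>g \<epsilon> x\<bar> \<le> c * (1 / \<epsilon> ^ N)"
    using assms(1) K unfolding locally_moderate_def by blast
  obtain M d where h: "\<forall>\<^sub>F \<epsilon> in at_right 0. \<forall>x\<in>K. \<bar>h \<epsilon> x\<bar> \<le> d * (1 / \<epsilon> ^ M)"
    using assms(2) K unfolding locally_moderate_def by blast
  from g h eventually_at_right_unit_interval
  have "\<forall>\<^sub>F \<epsilon> in at_right 0. \<forall>x\<in>K. \<bar>g \<epsilon> x - h \<epsilon> x\<bar> \<le> (\<bar>c\<bar> + \<bar>d\<bar>) * (1 / \<epsilon> ^ (N + M))"
  proof eventually_elim
    case (elim \<epsilon>)
    have e: "0 < \<epsilon>" "\<epsilon> \<le> 1" using elim(3) by auto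
    then have "1 / \<epsilon> ^ N \<le> 1 / \<epsilon> ^ (N + M)" "1 / \<epsilon> ^ M \<le> 1 / \<epsilon> ^ (N + M)"
      by (auto intro!: divide_left_mono power_decreasing)
    then have "\<bar>c\<bar> * (1 / \<epsilon> ^ N) + \<bar>d\<bar> * (1 / \<epsilon> ^ M) \<le> (\<bar>c\<bar> + \<bar>d\<bar>) * (1 / \<epsilon> ^ (N + M))"
      unfolding distrib_right by (intro add_mono mult_left_mono) auto
    moreover have "c * (1 / \<epsilon> ^ N) \<le> \<bar>c\<bar> * (1 / \<epsilon> ^ N)" "d * (1 / \<epsilon> ^ M) \<le> \<bar>d\<bar> * (1 / \<epsilon> ^ M)"
      using e by (intro mult_right_mono; simp)+
    ultimately have "\<bar>c\<bar> * (1 / \<epsilon> ^ N) + \<bar>d\<bar> * (1 / \<epsilon> ^ M) \<le> (\<bar>c\<bar> + \<bar>d\<bar>) * (1 / \<epsilon> ^ (N + M))"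
      "c * (1 / \<epsilon> ^ N) + d * (1 / \<epsilon> ^ M) \<le> \<bar>c\<bar> * (1 / \<epsilon> ^ N) + \<bar>d\<bar> * (1 / \<epsilon> ^ M)"
      by (linarith)+
    then have *: "c * (1 / \<epsilon> ^ N) + d * (1 / \<epsilon> ^ M) \<le> (\<bar>c\<bar> + \<bar>d\<bar>) * (1 / \<epsilon> ^ (N + M))"
      by (rule order_trans[rotated])
    show ?case
    proof
      fix x assume "x \<in> K"
      with elim(1,2) have "\<bar>g \<epsilon> x\<bar> \<le> c * (1 / \<epsilon> ^ N)" "\<bar>h \<epsilon> x\<bar> \<le> d * (1 / \<epsilon> ^ M)" by blast+
      with * show "\<bar>g \<epsilon> x - h \<epsilon> x\<bar> \<le> (\<bar>c\<bar> + \<bar>d\<bar>) * (1 / \<epsilon> ^ (N + M))" by linarith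
    qed
  qed
  then show "\<exists>N c. \<forall>\<^sub>F \<epsilon> in at_right 0. \<forall>x\<in>K. \<bar>g \<epsilon> x - h \<epsilon> x\<bar> \<le> c * (1 / \<epsilon> ^ N)" by blast
qed

lemma locally_negligible_add:
  assumes "locally_negligible \<Omega> g" "locally_negligible \<Omega> h"
  shows "locally_negligible \<Omega> (\<lambda>\<epsilon> x. g \<epsilon> x + h \<epsilon> x)"
  unfolding locally_negligible_def
proof (intro allI impI, elim conjE)
  fix K m assume K: "compact K" "K \<subseteq> \<Omega>"
  obtain c where g: "\<forall>\<^sub>F \<epsilon> in at_right 0. \<forall>x\<in>K. \<bar>g \<epsilon> x\<bar> \<le> c * \<epsilon> ^ m"
    using assms(1) K unfolding locally_negligible_def by blast
  obtain d where h: "\<forall>\<^sub>F \<epsilon> in at_right 0. \<forall>x\<in>K. \<bar>h \<epsilon> x\<bar> \<le> d * \<epsilon> ^ m"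
    using assms(2) K unfolding locally_negligible_def by blast
  from g h have "\<forall>\<^sub>F \<epsilon> in at_right 0. \<forall>x\<in>K. \<bar>g \<epsilon> x + h \<epsilon> x\<bar> \<le> (c + d) * \<epsilon> ^ m"
  proof eventually_elim
    case (elim \<epsilon>)
    show ?case
    proof
      fix x assume "x \<in> K"
      with elim have "\<bar>g \<epsilon> x\<bar> \<le> c * \<epsilon> ^ m" "\<bar>h \<epsilon> x\<bar> \<le> d * \<epsilon> ^ m" by blast+
      then show "\<bar>g \<epsilon> x + h \<epsilon> x\<bar> \<le> (c + d) * \<epsilon> ^ m" unfolding distrib_right by linarith
    qed
  qed
  then show "\<exists>c. \<forall>\<^sub>F \<epsilon> in at_right 0. \<forall>x\<in>K. \<bar>g \<epsilon> x + h \<epsilon> x\<bar> \<le> c * \<epsilon> ^ m" by blast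
qed

lemma locally_moderate_at_point:
  assumes "open \<Omega>" "locally_moderate \<Omega> h" "p \<in> compact_gen_points \<Omega>" "x \<in> p"
  shows "(\<lambda>\<epsilon>. h \<epsilon> (x \<epsilon>)) \<in> moderate_nets"
proof -
  obtain K where K: "compact K" "K \<subseteq> \<Omega>" "\<forall>\<^sub>F \<epsilon> in at_right 0. x \<epsilon> \<in> K"
    by (rule compact_gen_point_eventually_in_compact[OF assms(1,3)]) (use assms(4) in blast)
  then obtain N c where "\<forall>\<^sub>F \<epsilon> in at_right 0. \<forall>x\<in>K. \<bar>h \<epsilon> x\<bar> \<le> c * (1 / \<epsilon> ^ N)"
    using assms(2) unfolding locally_moderate_def by blast
  with K(3) have "\<forall>\<^sub>F \<epsilon> in at_right 0. norm (h \<epsilon> (x \<epsilon>)) \<le> c * (1 / \<epsilon> ^ N)"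
    by eventually_elim simp
  then show ?thesis unfolding moderate_nets_iff by blast
qed

lemma locally_negligible_at_point:
  assumes "open \<Omega>" "locally_negligible \<Omega> h" "p \<in> compact_gen_points \<Omega>" "x \<in> p"
  shows "negligible_net (\<lambda>\<epsilon>. h \<epsilon> (x \<epsilon>))"
  unfolding negligible_net_iff
proof
  fix m
  obtain K where K: "compact K" "K \<subseteq> \<Omega>" "\<forall>\<^sub>F \<epsilon> in at_right 0. x \<epsilon> \<in> K"
    by (rule compact_gen_point_eventually_in_compact[OF assms(1,3)]) (use assms(4) in blast)
  then obtain c where "\<forall>\<^sub>F \<epsilon> in at_right 0. \<forall>x\<in>K. \<bar>h \<epsilon> x\<bar> \<le> c * \<epsilon> ^ m"
    using assms(2) unfolding locally_negligible_def by blast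
  with K(3) have "\<forall>\<^sub>F \<epsilon> in at_right 0. norm (h \<epsilon> (x \<epsilon>)) \<le> c * \<epsilon> ^ m"
    by eventually_elim simp
  then show "\<exists>c. \<forall>\<^sub>F \<epsilon> in at_right 0. norm (h \<epsilon> (x \<epsilon>)) \<le> c * \<epsilon> ^ m" by blast
qed

text \<open>Test the hypothesis on the net of maximizers of \<open>\<bar>h \<epsilon>\<bar>\<close> over \<open>K\<close>.\<close>

lemma locally_moderate_if_moderate_at_points:
  assumes cont: "\<And>K. compact K \<Longrightarrow> K \<subseteq> \<Omega> \<Longrightarrow> \<forall>\<^sub>F \<epsilon> in at_right 0. continuous_on K (h \<epsilon>)"
    and pt: "\<And>p x. p \<in> compact_gen_points \<Omega> \<Longrightarrow> x \<in> p \<Longrightarrow> (\<lambda>\<epsilon>. h \<epsilon> (x \<epsilon>)) \<in> moderate_nets"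
  shows "locally_moderate \<Omega> h"
  unfolding locally_moderate_def
proof (intro allI impI, elim conjE)
  fix K assume K: "compact K" "K \<subseteq> \<Omega>"
  show "\<exists>N c. \<forall>\<^sub>F \<epsilon> in at_right 0. \<forall>x\<in>K. \<bar>h \<epsilon> x\<bar> \<le> c * (1 / \<epsilon> ^ N)"
  proof (cases "K = {}")
    case False
    obtain y where y: "\<forall>\<epsilon>. y \<epsilon> \<in> K"
      "\<forall>\<^sub>F \<epsilon> in at_right 0. \<forall>x\<in>K. \<bar>h \<epsilon> x\<bar> \<le> \<bar>h \<epsilon> (y \<epsilon>)\<bar>"
      by (rule maximizing_net[OF K(1) False cont[OF K]])
    obtain N c where "\<forall>\<^sub>F \<epsilon> in at_right 0. norm (h \<epsilon> (y \<epsilon>)) \<le> c * (1 / \<epsilon> ^ N)"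
      using pt[OF net_in_compact[OF K y(1)]] unfolding moderate_nets_iff by blast
    with y(2) have "\<forall>\<^sub>F \<epsilon> in at_right 0. \<forall>x\<in>K. \<bar>h \<epsilon> x\<bar> \<le> c * (1 / \<epsilon> ^ N)"
      unfolding real_norm_def by eventually_elim (blast intro: order_trans)
    then show ?thesis by blast
  qed simp
qed

lemma locally_negligible_if_negligible_at_points:
  assumes cont: "\<And>K. compact K \<Longrightarrow> K \<subseteq> \<Omega> \<Longrightarrow> \<forall>\<^sub>F \<epsilon> in at_right 0. continuous_on K (h \<epsilon>)"
    and pt: "\<And>p x. p \<in> compact_gen_points \<Omega> \<Longrightarrow> x \<in> p \<Longrightarrow> negligible_net (\<lambda>\<epsilon>. h \<epsilon> (x \<epsilon>))"
  shows "locally_negligible \<Omega> h"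
  unfolding locally_negligible_def
proof (intro allI impI, elim conjE)
  fix K m assume K: "compact K" "K \<subseteq> \<Omega>"
  show "\<exists>c. \<forall>\<^sub>F \<epsilon> in at_right 0. \<forall>x\<in>K. \<bar>h \<epsilon> x\<bar> \<le> c * \<epsilon> ^ m"
  proof (cases "K = {}")
    case False
    obtain y where y: "\<forall>\<epsilon>. y \<epsilon> \<in> K"
      "\<forall>\<^sub>F \<epsilon> in at_right 0. \<forall>x\<in>K. \<bar>h \<epsilon> x\<bar> \<le> \<bar>h \<epsilon> (y \<epsilon>)\<bar>"
      by (rule maximizing_net[OF K(1) False cont[OF K]])
    obtain c where "\<forall>\<^sub>F \<epsilon> in at_right 0. norm (h \<epsilon> (y \<epsilon>)) \<le> c * \<epsilon> ^ m"
      using pt[OF net_in_compact[OF K y(1)]] unfolding negligible_net_iff by blast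
    with y(2) have "\<forall>\<^sub>F \<epsilon> in at_right 0. \<forall>x\<in>K. \<bar>h \<epsilon> x\<bar> \<le> c * \<epsilon> ^ m"
      unfolding real_norm_def by eventually_elim (blast intro: order_trans)
    then show ?thesis by blast
  qed simp
qed

text \<open>Let a net in \<open>K\<close> avoid \<open>A \<epsilon>\<close> whenever \<open>K\<close> is not contained in \<open>A \<epsilon>\<close>. It represents a compactly supported
  point, so it must eventually lie in \<open>A \<epsilon>\<close>.\<close>

lemma eventually_compact_subset:
  assumes "compact K" "K \<subseteq> \<Omega>"
    and pt: "\<And>p x. p \<in> compact_gen_points \<Omega> \<Longrightarrow> x \<in> p \<Longrightarrow> \<forall>\<^sub>F \<epsilon> in at_right 0. x \<epsilon> \<in> A \<epsilon>"
  shows "\<forall>\<^sub>F \<epsilon> in at_right 0. K \<subseteq> A \<epsilon>"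
proof (cases "K = {}")
  case False
  then have "\<exists>y\<in>K. \<not> K \<subseteq> A \<epsilon> \<longrightarrow> y \<notin> A \<epsilon>" for \<epsilon> by blast
  then obtain y where y: "\<forall>\<epsilon>. y \<epsilon> \<in> K" "\<And>\<epsilon>. \<not> K \<subseteq> A \<epsilon> \<Longrightarrow> y \<epsilon> \<notin> A \<epsilon>" by metis
  from pt[OF net_in_compact[OF assms(1,2) y(1)]] show ?thesis
    by (rule eventually_mono) (use y(2) in blast)
qed simp

lemma abs_diff_le_partial_bound:
  fixes f :: "real ^ 'd \<Rightarrow> real"
  assumes diff: "\<And>z. z \<in> closed_segment x y \<Longrightarrow> f differentiable (at z)"
    and bound: "\<And>z i. z \<in> closed_segment x y \<Longrightarrow> \<bar>partial i f z\<bar> \<le> B"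
  shows "\<bar>f x - f y\<bar> \<le> of_nat CARD('d) * B * norm (x - y)"
proof -
  have "norm (f x - f y) \<le> (of_nat CARD('d) * B) * norm (x - y)"
  proof (rule differentiable_bound[OF convex_closed_segment])
    fix z assume z: "z \<in> closed_segment x y"
    let ?D = "frechet_derivative f (at z)"
    have D: "(f has_derivative ?D) (at z)" using diff[OF z] frechet_derivative_works by blast
    then show "(f has_derivative ?D) (at z within closed_segment x y)"
      by (rule has_derivative_at_withinI)
    have lin: "linear ?D" using D by (rule has_derivative_linear)
    have "norm (?D v) \<le> of_nat CARD('d) * B * norm v" for v
    proof -
      have "?D v = ?D (\<Sum>i\<in>UNIV. v $ i *\<^sub>R axis i 1)"
        using basis_expansion[of v] by (simp add: scalar_mult_eq_scaleR)
      also have "\<dots> = (\<Sum>i\<in>UNIV. v $ i * partial i f z)"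
        using lin by (simp add: linear_sum linear_cmul partial_def)
      also have "norm \<dots> \<le> (\<Sum>i\<in>(UNIV :: 'd set). norm v * B)"
        using bound[OF z] component_le_norm_cart[of v]
        by (intro order_trans[OF norm_sum] sum_mono) (auto simp: abs_mult intro!: mult_mono)
      finally show ?thesis by (simp add: mult_ac)
    qed
    then show "onorm ?D \<le> of_nat CARD('d) * B" by (rule onorm_le)
  qed simp_all
  then show ?thesis by simp
qed

text \<open>Mean value theorem: the moderate growth of the gradient along the segment is absorbed by the
  negligible distance of the two representatives.\<close>

lemma negligible_net_eval_diff:
  fixes h :: "real \<Rightarrow> real ^ 'd \<Rightarrow> real"
  assumes "open \<Omega>" "\<And>\<epsilon>. \<epsilon> \<in> {0<..1} \<Longrightarrow> smooth_on \<Omega> (h \<epsilon>)"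
    and mod: "\<And>i. locally_moderate \<Omega> (\<lambda>\<epsilon>. partial i (h \<epsilon>))"
    and p: "p \<in> compact_gen_points \<Omega>" "x \<in> p" "y \<in> p"
  shows "negligible_net (\<lambda>\<epsilon>. h \<epsilon> (x \<epsilon>) - h \<epsilon> (y \<epsilon>))"
  unfolding negligible_net_iff
proof
  fix m
  obtain K where K: "compact K" "K \<subseteq> \<Omega>"
    "\<forall>\<^sub>F \<epsilon> in at_right 0. closed_segment (x \<epsilon>) (y \<epsilon>) \<subseteq> K"
    by (rule compact_gen_pointsE[OF assms(1) p(1)]) (use p(2,3) in blast)
  have "\<forall>i. \<exists>N c. \<forall>\<^sub>F \<epsilon> in at_right 0. \<forall>x\<in>K. \<bar>partial i (h \<epsilon>) x\<bar> \<le> c * (1 / \<epsilon> ^ N)"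
    using mod K(1,2) unfolding locally_moderate_def by blast
  then obtain N c where Nc: "\<forall>i. \<forall>\<^sub>F \<epsilon> in at_right 0. \<forall>x\<in>K. \<bar>partial i (h \<epsilon>) x\<bar> \<le> c i * (1 / \<epsilon> ^ N i)"
    unfolding choice_iff by blast
  define M where "M = (MAX i. N i)"
  define C where "C = (MAX i. \<bar>c i\<bar>)"
  have "\<forall>\<^sub>F \<epsilon> in at_right 0. \<forall>i. \<forall>x\<in>K. \<bar>partial i (h \<epsilon>) x\<bar> \<le> c i * (1 / \<epsilon> ^ N i)"
    by (rule eventually_all_finite) (use Nc in blast)
  moreover obtain d where "\<forall>\<^sub>F \<epsilon> in at_right 0. norm (x \<epsilon> - y \<epsilon>) \<le> d * \<epsilon> ^ (M + m)"
    using compact_gen_point_rel[OF p] unfolding net_rel_iff negligible_net_iff by blast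
  ultimately have "\<forall>\<^sub>F \<epsilon> in at_right 0.
      norm (h \<epsilon> (x \<epsilon>) - h \<epsilon> (y \<epsilon>)) \<le> (of_nat CARD('d) * C * d) * \<epsilon> ^ m"
    using K(3) eventually_at_right_unit_interval
  proof eventually_elim
    case (elim \<epsilon>)
    then have e: "0 < \<epsilon>" "\<epsilon> \<le> 1" by auto
    have C: "\<bar>c i\<bar> \<le> C" and M: "N i \<le> M" for i unfolding C_def M_def by auto
    have C0: "C \<ge> 0" using order_trans[OF abs_ge_zero C] .
    have B: "c i * (1 / \<epsilon> ^ N i) \<le> C * (1 / \<epsilon> ^ M)" for i
    proof (rule mult_mono)
      show "c i \<le> C" using C[of i] by linarith
      show "1 / \<epsilon> ^ N i \<le> 1 / \<epsilon> ^ M"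
        using e M[of i] by (auto intro!: divide_left_mono power_decreasing)
    qed (use C0 e in auto)
    have "norm (h \<epsilon> (x \<epsilon>) - h \<epsilon> (y \<epsilon>)) \<le> of_nat CARD('d) * (C * (1 / \<epsilon> ^ M)) * norm (x \<epsilon> - y \<epsilon>)"
      unfolding real_norm_def
    proof (rule abs_diff_le_partial_bound)
      fix z assume z: "z \<in> closed_segment (x \<epsilon>) (y \<epsilon>)"
      then show "h \<epsilon> differentiable (at z)"
        using elim K(2) by (intro smooth_on_imp_differentiable[OF assms(2)]) auto
      show "\<bar>partial i (h \<epsilon>) z\<bar> \<le> C * (1 / \<epsilon> ^ M)" for i
        using elim(1,3) z by (intro order_trans[OF _ B[of i]]) blast
    qed
    also have "\<dots> \<le> of_nat CARD('d) * (C * (1 / \<epsilon> ^ M)) * (d * \<epsilon> ^ (M + m))"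
      using elim C0 e by (intro mult_left_mono) auto
    also have "\<dots> = (of_nat CARD('d) * C * d) * \<epsilon> ^ m"
      using e by (simp add: power_add)
    finally show ?case .
  qed
  then show "\<exists>c. \<forall>\<^sub>F \<epsilon> in at_right 0. norm (h \<epsilon> (x \<epsilon>) - h \<epsilon> (y \<epsilon>)) \<le> c * \<epsilon> ^ m" by blast
qed

text \<open>Landau's interpolation inequality. On the segment of length \<open>t\<close> from \<open>x\<close> in direction \<open>j\<close>, the
  derivative at some intermediate point is the difference quotient, of size at most \<open>2 A / t\<close>, and
  it differs from the derivative at \<open>x\<close> by at most \<open>t B\<close>.\<close>

lemma abs_partial_le_interpolation:
  fixes f :: "real ^ 'd \<Rightarrow> real"
  assumes "open \<Omega>" "smooth_on \<Omega> f" "cball x t \<subseteq> \<Omega>" "t > 0"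
    and A: "\<And>z. z \<in> cball x t \<Longrightarrow> \<bar>f z\<bar> \<le> A"
    and B: "\<And>z. z \<in> cball x t \<Longrightarrow> \<bar>partial j (partial j f) z\<bar> \<le> B"
  shows "\<bar>partial j f x\<bar> \<le> 2 * A / t + t * B"
proof -
  define l where "l s = x + s *\<^sub>R axis j (1 :: real)" for s
  have l: "l s \<in> cball x t" if "0 \<le> s" "s \<le> t" for s
    using that by (simp add: l_def dist_norm)
  have deriv: "((\<lambda>s. g (l s)) has_real_derivative partial j g (l s)) (at s)"
    if "smooth_on \<Omega> g" "0 \<le> s" "s \<le> t" for g s
  proof -
    have "(g has_derivative frechet_derivative g (at (l s))) (at (l s))"
      using smooth_on_imp_differentiable[OF that(1)] l[OF that(2,3)] assms(3)
      by (auto simp: frechet_derivative_works[symmetric])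
    moreover have "(l has_derivative (\<lambda>r. r *\<^sub>R axis j 1)) (at s)"
      unfolding l_def by (auto intro!: derivative_eq_intros)
    ultimately have "((\<lambda>s. g (l s)) has_derivative
        (\<lambda>r. frechet_derivative g (at (l s)) (r *\<^sub>R axis j 1))) (at s)"
      by (rule has_derivative_compose[rotated])
    moreover have "linear (frechet_derivative g (at (l s)))"
      using \<open>(g has_derivative frechet_derivative g (at (l s))) (at (l s))\<close>
      by (rule has_derivative_linear)
    ultimately show ?thesis
      by (simp add: has_field_derivative_def linear_cmul partial_def mult.commute[of _ "frechet_derivative _ _ _"])
  qed
  obtain s where s: "0 < s" "s < t" "f (l t) - f (l 0) = (t - 0) * partial j f (l s)"
    using MVT2[OF assms(4), of "\<lambda>s. f (l s)" "\<lambda>s. partial j f (l s)"] deriv[OF assms(2)] by auto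
  obtain r where r: "0 < r" "r < s"
    "partial j f (l s) - partial j f (l 0) = (s - 0) * partial j (partial j f) (l r)"
    using MVT2[OF s(1), of "\<lambda>s. partial j f (l s)" "\<lambda>s. partial j (partial j f) (l s)"]
      deriv[OF smooth_on_partial[OF assms(2)]] s(2) by auto
  have "\<bar>f (l t) - f (l 0)\<bar> \<le> 2 * A"
    using A[OF l, of t] A[OF l, of 0] assms(4) by auto
  then have "\<bar>partial j f (l s)\<bar> \<le> 2 * A / t"
    using s(3) assms(4) by (simp add: abs_mult field_simps)
  moreover have "\<bar>partial j f (l s) - partial j f (l 0)\<bar> \<le> t * B"
    unfolding r(3) abs_mult using B[OF l, of r] r s by (intro mult_mono) auto
  ultimately have "\<bar>partial j f (l 0)\<bar> \<le> 2 * A / t + t * B" by linarith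
  then show ?thesis by (simp add: l_def)
qed

text \<open>Interpolation with the step \<open>t = e * \<epsilon> ^ (m + N)\<close>: the growth \<open>\<epsilon>\<^sup>-\<^sup>N\<close> of the second derivative
  is beaten by \<open>t\<close>, and the loss \<open>1 / t\<close> is beaten by the negligibility of \<open>h\<close>.\<close>

lemma locally_negligible_partial:
  fixes h :: "real \<Rightarrow> real ^ 'd \<Rightarrow> real"
  assumes "open \<Omega>" "\<And>\<epsilon>. \<epsilon> \<in> {0<..1} \<Longrightarrow> smooth_on \<Omega> (h \<epsilon>)"
    and neg: "locally_negligible \<Omega> h"
    and mod: "locally_moderate \<Omega> (\<lambda>\<epsilon>. partial j (partial j (h \<epsilon>)))"
  shows "locally_negligible \<Omega> (\<lambda>\<epsilon>. partial j (h \<epsilon>))"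
  unfolding locally_negligible_def
proof (intro allI impI, elim conjE)
  fix K m assume K: "compact K" "K \<subseteq> \<Omega>"
  obtain e K' where K': "e > 0" "compact K'" "K' \<subseteq> \<Omega>" "\<forall>x\<in>K. cball x e \<subseteq> K'"
    by (rule compact_thickening[OF K(1) assms(1) K(2)])
  obtain N b where b: "\<forall>\<^sub>F \<epsilon> in at_right 0. \<forall>x\<in>K'. \<bar>partial j (partial j (h \<epsilon>)) x\<bar> \<le> b * (1 / \<epsilon> ^ N)"
    using mod K'(2,3) unfolding locally_moderate_def by blast
  obtain a where a: "\<forall>\<^sub>F \<epsilon> in at_right 0. \<forall>x\<in>K'. \<bar>h \<epsilon> x\<bar> \<le> a * \<epsilon> ^ (m + (m + N))"
    using neg K'(2,3) unfolding locally_negligible_def by blast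
  \<comment> \<open>division by the step \<open>t\<close> leaves \<open>m\<close> of the exponent \<open>m + (m + N)\<close>\<close>
  from a b eventually_at_right_unit_interval
  have "\<forall>\<^sub>F \<epsilon> in at_right 0. \<forall>x\<in>K. \<bar>partial j (h \<epsilon>) x\<bar> \<le> (2 * a / e + e * b) * \<epsilon> ^ m"
  proof eventually_elim
    case (elim \<epsilon>)
    then have \<epsilon>: "0 < \<epsilon>" "\<epsilon> \<le> 1" by auto
    define t where "t = e * \<epsilon> ^ (m + N)"
    have t: "0 < t" "t \<le> e"
      using \<epsilon> K'(1) by (auto simp: t_def intro!: mult_left_le power_le_one)
    show ?case
    proof
      fix x assume x: "x \<in> K"
      have sub: "cball x t \<subseteq> K'" using K'(4)[rule_format, OF x] subset_cball[OF t(2), of x] by (rule order_trans[rotated])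
      have "\<bar>partial j (h \<epsilon>) x\<bar> \<le> 2 * (a * \<epsilon> ^ (m + (m + N))) / t + t * (b * (1 / \<epsilon> ^ N))"
        using elim sub K'(3) by (intro abs_partial_le_interpolation[OF assms(1) assms(2)] t(1)) auto
      also have "\<dots> = (2 * a / e + e * b) * \<epsilon> ^ m"
        using \<epsilon> K'(1) by (simp add: t_def power_add field_simps)
      finally show "\<bar>partial j (h \<epsilon>) x\<bar> \<le> (2 * a / e + e * b) * \<epsilon> ^ m" .
    qed
  qed
  then show "\<exists>c. \<forall>\<^sub>F \<epsilon> in at_right 0. \<forall>x\<in>K. \<bar>partial j (h \<epsilon>) x\<bar> \<le> c * \<epsilon> ^ m" by blast
qed

text \<open>A moderate net is negligible as soon as its values are: no derivatives have to be tested. The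
  interpolation argument raises one exponent at a time; the directions are added from the end of
  \<open>coord_list\<close>, so that the new derivative is always the outermost one.\<close>

lemma negligible_if_moderate_and_locally_negligible:
  assumes "open \<Omega>" "w \<in> colombeau_moderate \<Omega>" "locally_negligible \<Omega> w"
  shows "w \<in> colombeau_negligible \<Omega>"
proof -
  have smooth: "smooth_on \<Omega> (w \<epsilon>)" if "\<epsilon> \<in> {0<..1}" for \<epsilon>
    using assms(2) that by (simp add: colombeau_moderate_iff)
  have mod: "locally_moderate \<Omega> (\<lambda>\<epsilon>. multi_partial \<alpha> (w \<epsilon>))" for \<alpha>
    using assms(2) by (simp add: colombeau_moderate_iff)
  have "locally_negligible \<Omega> (\<lambda>\<epsilon>. multi_partial \<alpha> (w \<epsilon>))"
    if "coord_list = is @ js" "\<forall>i\<in>set is. \<alpha> i = 0" for \<alpha> "is" js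
    using that
  proof (induction js arbitrary: "is" \<alpha>)
    case Nil
    then have "\<alpha> = (\<lambda>i. 0)" using set_coord_list by fastforce
    then show ?case using assms(3) by (simp add: multi_partial_zero)
  next
    case (Cons j js)
    define g where "g n \<epsilon> = multi_partial (\<alpha>(j := n)) (w \<epsilon>)" for n \<epsilon>
    have g: "g n \<epsilon> = (partial j ^^ n) (g 0 \<epsilon>)" for n \<epsilon>
      unfolding g_def using Cons.prems by (intro multi_partial_fun_upd) auto
    have "locally_negligible \<Omega> (g n)" for n
    proof (induction n)
      case 0
      show ?case unfolding g_def using Cons.prems by (intro Cons.IH[of "is @ [j]"]) auto
    next
      case (Suc n)
      have "locally_moderate \<Omega> (g (Suc (Suc n)))" unfolding g_def using mod .
      moreover have "smooth_on \<Omega> (g n \<epsilon>)" if "\<epsilon> \<in> {0<..1}" for \<epsilon>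
        unfolding g_def using smooth[OF that] by (rule smooth_on_multi_partial)
      moreover have Suc_eq: "g (Suc n) = (\<lambda>\<epsilon>. partial j (g n \<epsilon>))" for n
      proof
        show "g (Suc n) \<epsilon> = partial j (g n \<epsilon>)" for \<epsilon> using g[of "Suc n" \<epsilon>] g[of n \<epsilon>] by simp
      qed
      ultimately show ?case unfolding Suc_eq
        using Suc assms(1) by (intro locally_negligible_partial)
    qed
    from this[of "\<alpha> j"] show ?case unfolding g_def fun_upd_triv .
  qed
  from this[of "[]" coord_list] have "locally_negligible \<Omega> (\<lambda>\<epsilon>. multi_partial \<alpha> (w \<epsilon>))" for \<alpha>
    by simp
  then show ?thesis using smooth by (simp add: colombeau_negligible_iff)
qed

section \<open>Evaluation at generalized points and injectivity\<close>

lemma locally_moderate_cong: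
  assumes "locally_moderate \<Omega> g" "\<forall>\<^sub>F \<epsilon> in at_right 0. \<forall>x\<in>\<Omega>. g \<epsilon> x = h \<epsilon> x"
  shows "locally_moderate \<Omega> h"
  unfolding locally_moderate_def
proof (intro allI impI, elim conjE)
  fix K assume K: "compact K" "K \<subseteq> \<Omega>"
  then obtain N c where "\<forall>\<^sub>F \<epsilon> in at_right 0. \<forall>x\<in>K. \<bar>g \<epsilon> x\<bar> \<le> c * (1 / \<epsilon> ^ N)"
    using assms(1) unfolding locally_moderate_def by blast
  with assms(2) have "\<forall>\<^sub>F \<epsilon> in at_right 0. \<forall>x\<in>K. \<bar>h \<epsilon> x\<bar> \<le> c * (1 / \<epsilon> ^ N)"
    by eventually_elim (use K(2) in force)
  then show "\<exists>N c. \<forall>\<^sub>F \<epsilon> in at_right 0. \<forall>x\<in>K. \<bar>h \<epsilon> x\<bar> \<le> c * (1 / \<epsilon> ^ N)" by blast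
qed

lemma colombeau_moderate_diff:
  assumes "open \<Omega>" "u \<in> colombeau_moderate \<Omega>" "v \<in> colombeau_moderate \<Omega>"
  shows "(\<lambda>\<epsilon> x. u \<epsilon> x - v \<epsilon> x) \<in> colombeau_moderate \<Omega>"
proof -
  have smooth: "smooth_on \<Omega> (u \<epsilon>)" "smooth_on \<Omega> (v \<epsilon>)" if "\<epsilon> \<in> {0<..1}" for \<epsilon>
    using assms(2,3) that by (simp_all add: colombeau_moderate_iff)
  have "locally_moderate \<Omega> (\<lambda>\<epsilon>. multi_partial \<alpha> (\<lambda>x. u \<epsilon> x - v \<epsilon> x))" for \<alpha>
  proof (rule locally_moderate_cong)
    show "locally_moderate \<Omega> (\<lambda>\<epsilon> x. multi_partial \<alpha> (u \<epsilon>) x - multi_partial \<alpha> (v \<epsilon>) x)"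
      using assms(2,3) by (intro locally_moderate_diff) (simp_all add: colombeau_moderate_iff)
    show "\<forall>\<^sub>F \<epsilon> in at_right 0. \<forall>x\<in>\<Omega>. multi_partial \<alpha> (u \<epsilon>) x - multi_partial \<alpha> (v \<epsilon>) x =
        multi_partial \<alpha> (\<lambda>x. u \<epsilon> x - v \<epsilon> x) x"
      using eventually_at_right_unit_interval
      by eventually_elim (simp add: multi_partial_diff[OF assms(1)] smooth)
  qed
  moreover have "smooth_on \<Omega> (\<lambda>x. u \<epsilon> x - v \<epsilon> x)" if "\<epsilon> \<in> {0<..1}" for \<epsilon>
    using smooth[OF that] by (rule smooth_on_diff[OF assms(1)])
  ultimately show ?thesis unfolding colombeau_moderate_iff by blast
qed

text \<open>Since derivatives are controlled automatically, equality in the algebra is a condition on values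
  only. That it is an equivalence relation, and that point values determine the class, are then
  immediate.\<close>

lemma colombeau_rel_iff:
  assumes "open \<Omega>"
  shows "(u, v) \<in> colombeau_rel \<Omega> \<longleftrightarrow> u \<in> colombeau_moderate \<Omega> \<and> v \<in> colombeau_moderate \<Omega> \<and>
    locally_negligible \<Omega> (\<lambda>\<epsilon> x. u \<epsilon> x - v \<epsilon> x)"
proof -
  have "locally_negligible \<Omega> w" if "w \<in> colombeau_negligible \<Omega>" for w
  proof -
    have "locally_negligible \<Omega> (\<lambda>\<epsilon>. multi_partial (\<lambda>i. 0) (w \<epsilon>))"
      using that unfolding colombeau_negligible_iff by blast
    then show ?thesis by (simp add: multi_partial_zero)
  qed
  then show ?thesis
    using negligible_if_moderate_and_locally_negligible[OF assms colombeau_moderate_diff[OF assms]]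
    unfolding colombeau_rel_def by blast
qed

lemma equiv_colombeau_rel:
  assumes "open \<Omega>"
  shows "equiv (colombeau_moderate \<Omega>) (colombeau_rel \<Omega>)"
proof (rule equivI)
  show "colombeau_rel \<Omega> \<subseteq> colombeau_moderate \<Omega> \<times> colombeau_moderate \<Omega>"
    by (rule subrelI) (simp add: colombeau_rel_iff[OF assms])
  show "refl_on (colombeau_moderate \<Omega>) (colombeau_rel \<Omega>)"
    by (rule refl_onI) (auto simp: colombeau_rel_iff[OF assms] locally_negligible_def intro!: exI[of _ 0])
  show "sym (colombeau_rel \<Omega>)"
    by (rule symI) (simp add: colombeau_rel_iff[OF assms] locally_negligible_def abs_minus_commute)
  show "trans (colombeau_rel \<Omega>)"
  proof (rule transI)
    fix u v w assume "(u, v) \<in> colombeau_rel \<Omega>" "(v, w) \<in> colombeau_rel \<Omega>"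
    then show "(u, w) \<in> colombeau_rel \<Omega>"
      using locally_negligible_add[of \<Omega> "\<lambda>\<epsilon> x. u \<epsilon> x - v \<epsilon> x" "\<lambda>\<epsilon> x. v \<epsilon> x - w \<epsilon> x"]
      by (simp add: colombeau_rel_iff[OF assms])
  qed
qed

lemma multi_partial_at_point_moderate:
  assumes "open \<Omega>" "u \<in> colombeau_moderate \<Omega>" "p \<in> compact_gen_points \<Omega>" "x \<in> p"
  shows "(\<lambda>\<epsilon>. multi_partial \<alpha> (u \<epsilon>) (x \<epsilon>)) \<in> moderate_nets"
  by (rule locally_moderate_at_point[OF assms(1) _ assms(3,4)])
    (use assms(2) in \<open>unfold colombeau_moderate_iff, blast\<close>)

lemma eval_at_point_moderate:
  assumes "open \<Omega>" "u \<in> colombeau_moderate \<Omega>" "p \<in> compact_gen_points \<Omega>" "x \<in> p"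
  shows "(\<lambda>\<epsilon>. u \<epsilon> (x \<epsilon>)) \<in> moderate_nets"
  using multi_partial_at_point_moderate[OF assms, of "\<lambda>i. 0"] by (simp add: multi_partial_zero)

text \<open>Split \<open>u(x) - v(y) = (u(x) - u(y)) + (u(y) - v(y))\<close>: the first part is negligible because the
  gradient of \<open>u\<close> is moderate, the second because \<open>u - v\<close> is negligible.\<close>

lemma eval_at_point_rel:
  assumes "open \<Omega>" "(u, v) \<in> colombeau_rel \<Omega>" "p \<in> compact_gen_points \<Omega>" "x \<in> p" "y \<in> p"
  shows "net_class (\<lambda>\<epsilon>. u \<epsilon> (x \<epsilon>)) = net_class (\<lambda>\<epsilon>. v \<epsilon> (y \<epsilon>))"
proof -
  have u: "u \<in> colombeau_moderate \<Omega>" and v: "v \<in> colombeau_moderate \<Omega>"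
    and uv: "locally_negligible \<Omega> (\<lambda>\<epsilon> x. u \<epsilon> x - v \<epsilon> x)"
    using assms(2) by (simp_all add: colombeau_rel_iff[OF assms(1)])
  have mod: "locally_moderate \<Omega> (\<lambda>\<epsilon>. partial i (u \<epsilon>))" for i
  proof -
    have "locally_moderate \<Omega> (\<lambda>\<epsilon>. multi_partial ((\<lambda>i. 0)(i := 1)) (u \<epsilon>))"
      using u unfolding colombeau_moderate_iff by blast
    then show ?thesis by (simp add: multi_partial_axis)
  qed
  have "negligible_net (\<lambda>\<epsilon>. u \<epsilon> (x \<epsilon>) - u \<epsilon> (y \<epsilon>))"
    by (rule negligible_net_eval_diff[OF assms(1) _ mod assms(3-5)])
      (use u in \<open>simp add: colombeau_moderate_iff\<close>)
  from negligible_net_add[OF this locally_negligible_at_point[OF assms(1) uv assms(3,5)]]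
  have "negligible_net (\<lambda>\<epsilon>. u \<epsilon> (x \<epsilon>) - v \<epsilon> (y \<epsilon>))" by simp
  then show ?thesis
    using eval_at_point_moderate[OF assms(1) u assms(3,4)] eval_at_point_moderate[OF assms(1) v assms(3,5)]
    by (simp add: net_class_eq_iff)
qed

lemma colombeau_eval_class:
  assumes "open \<Omega>" "u \<in> colombeau_moderate \<Omega>" "p \<in> compact_gen_points \<Omega>" "x \<in> p"
  shows "colombeau_eval \<Omega> (colombeau_class \<Omega> u) p = net_class (\<lambda>\<epsilon>. u \<epsilon> (x \<epsilon>))"
proof -
  have "(u, u) \<in> colombeau_rel \<Omega>"
    using equiv_colombeau_rel[OF assms(1)] assms(2) by (meson equivE refl_onD)
  then have "u \<in> colombeau_class \<Omega> u" by (simp add: colombeau_class_def)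
  moreover have "net_class (\<lambda>\<epsilon>. v \<epsilon> (y \<epsilon>)) = net_class (\<lambda>\<epsilon>. u \<epsilon> (x \<epsilon>))"
    if "v \<in> colombeau_class \<Omega> u" "y \<in> p" for v y
    using eval_at_point_rel[OF assms(1) _ assms(3,4) that(2), of u v] that(1)
    by (simp add: colombeau_class_def)
  ultimately have "(\<Union>v\<in>colombeau_class \<Omega> u. \<Union>y\<in>p. net_class (\<lambda>\<epsilon>. v \<epsilon> (y \<epsilon>))) = net_class (\<lambda>\<epsilon>. u \<epsilon> (x \<epsilon>))"
    using assms(4) by blast
  then show ?thesis using assms(3) by (simp add: colombeau_eval_def)
qed

lemma colombeau_eval_in_gen_smooth_funs:
  assumes "open \<Omega>" "u \<in> colombeau_moderate \<Omega>"
  shows "colombeau_eval \<Omega> (colombeau_class \<Omega> u) \<in> gen_smooth_funs (compact_gen_points \<Omega>) gen_space"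
proof -
  let ?X = "compact_gen_points \<Omega>"
  have gen: "net_class (\<lambda>\<epsilon>. u \<epsilon> (x \<epsilon>)) \<in> gen_space" if "p \<in> ?X" "x \<in> p" for p x
    using eval_at_point_moderate[OF assms that] by (rule net_class_in_gen_space)
  have "?X \<subseteq> strongly_internal (\<lambda>_. \<Omega>)"
  proof
    fix p assume p: "p \<in> ?X"
    obtain K where K: "compact K" "K \<subseteq> \<Omega>" "\<And>x. x \<in> p \<Longrightarrow> \<forall>\<^sub>F \<epsilon> in at_right 0. x \<epsilon> \<in> K"
      using compact_gen_point_eventually_in_compact[OF assms(1) p] by blast
    have "\<forall>\<^sub>F \<epsilon> in at_right 0. x \<epsilon> \<in> \<Omega>" if "x \<in> p" for x
      using K(3)[OF that] by (rule eventually_mono) (use K(2) in blast)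
    then show "p \<in> strongly_internal (\<lambda>_. \<Omega>)"
      using p compact_gen_points_subset_gen_space by (auto simp: strongly_internal_def)
  qed
  then have "defines_gsm ?X gen_space (\<lambda>_. \<Omega>) u"
    unfolding defines_gsm_def
    using gen multi_partial_at_point_moderate[OF assms] assms by (simp add: colombeau_moderate_iff)
  moreover have "colombeau_eval \<Omega> (colombeau_class \<Omega> u) \<in> ?X \<rightarrow>\<^sub>E gen_space"
  proof (rule PiE_I)
    fix p assume p: "p \<in> ?X"
    then obtain x where x: "x \<in> p" using compact_gen_points_nonempty by blast
    show "colombeau_eval \<Omega> (colombeau_class \<Omega> u) p \<in> gen_space"
      unfolding colombeau_eval_class[OF assms p x] by (rule gen[OF p x])
  qed (simp add: colombeau_eval_def)
  moreover have "\<forall>p\<in>?X. \<forall>x\<in>p. colombeau_eval \<Omega> (colombeau_class \<Omega> u) p = net_class (\<lambda>\<epsilon>. u \<epsilon> (x \<epsilon>))"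
    using colombeau_eval_class[OF assms] by blast
  ultimately show ?thesis unfolding gen_smooth_funs_def by blast
qed

lemma colombeau_class_eq_if_eval_eq:
  assumes "open \<Omega>" "u \<in> colombeau_moderate \<Omega>" "v \<in> colombeau_moderate \<Omega>"
    and eq: "colombeau_eval \<Omega> (colombeau_class \<Omega> u) = colombeau_eval \<Omega> (colombeau_class \<Omega> v)"
  shows "colombeau_class \<Omega> u = colombeau_class \<Omega> v"
proof -
  let ?w = "\<lambda>\<epsilon> x. u \<epsilon> x - v \<epsilon> x"
  have w: "?w \<in> colombeau_moderate \<Omega>" using colombeau_moderate_diff[OF assms(1-3)] .
  have "locally_negligible \<Omega> ?w"
  proof (rule locally_negligible_if_negligible_at_points)
    fix K assume K: "K \<subseteq> \<Omega>"
    show "\<forall>\<^sub>F \<epsilon> in at_right 0. continuous_on K (?w \<epsilon>)"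
      using eventually_continuous_on[OF _ K, of ?w "\<lambda>i. 0"] w
      by (simp add: multi_partial_zero colombeau_moderate_iff)
  next
    fix p x assume px: "p \<in> compact_gen_points \<Omega>" "x \<in> p"
    then have "net_class (\<lambda>\<epsilon>. u \<epsilon> (x \<epsilon>)) = net_class (\<lambda>\<epsilon>. v \<epsilon> (x \<epsilon>))"
      using eq colombeau_eval_class[OF assms(1,2) px] colombeau_eval_class[OF assms(1,3) px] by simp
    then show "negligible_net (\<lambda>\<epsilon>. ?w \<epsilon> (x \<epsilon>))"
      using net_class_eq_iff[OF eval_at_point_moderate[OF assms(1,2) px]
          eval_at_point_moderate[OF assms(1,3) px]] by blast
  qed
  then have "(u, v) \<in> colombeau_rel \<Omega>"
    using assms by (simp add: colombeau_rel_iff)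
  then show ?thesis
    unfolding colombeau_class_def using equiv_class_eq[OF equiv_colombeau_rel[OF assms(1)]] by blast
qed

section \<open>Surjectivity\<close>

text \<open>Take \<open>\<nu> \<epsilon>\<close> to be the largest \<open>n \<le> 1 / \<epsilon>\<close> with \<open>P n \<epsilon>\<close>; the bound by \<open>1 / \<epsilon>\<close> makes the
  maximum exist and does not prevent \<open>\<nu>\<close> from tending to infinity.\<close>

lemma diagonal_index:
  fixes P :: "nat \<Rightarrow> real \<Rightarrow> bool"
  assumes "\<And>n. \<forall>\<^sub>F \<epsilon> in at_right 0. P n \<epsilon>" "\<And>\<epsilon>. P 0 \<epsilon>"
  obtains \<nu> where "\<forall>\<epsilon>. P (\<nu> \<epsilon>) \<epsilon>" "\<forall>m. \<forall>\<^sub>F \<epsilon> in at_right 0. m \<le> \<nu> \<epsilon>"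
proof -
  define A where "A \<epsilon> = {n. n \<le> nat \<lfloor>1 / \<epsilon>\<rfloor> \<and> P n \<epsilon>}" for \<epsilon>
  define \<nu> where "\<nu> \<epsilon> = Max (A \<epsilon>)" for \<epsilon>
  have fin: "finite (A \<epsilon>)" for \<epsilon>
    unfolding A_def by simp
  have "0 \<in> A \<epsilon>" for \<epsilon> unfolding A_def using assms(2) by simp
  then have "\<nu> \<epsilon> \<in> A \<epsilon>" for \<epsilon> unfolding \<nu>_def by (intro Max_in fin) blast
  then have 1: "\<forall>\<epsilon>. P (\<nu> \<epsilon>) \<epsilon>" unfolding A_def by blast
  have "\<forall>\<^sub>F \<epsilon> in at_right 0. m \<le> \<nu> \<epsilon>" for m
  proof -
    have "\<forall>\<^sub>F \<epsilon> :: real in at_right 0. real m \<le> inverse \<epsilon>"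
      using filterlim_inverse_at_top_right unfolding filterlim_at_top by blast
    with assms(1)[of m] show ?thesis
    proof eventually_elim
      case (elim \<epsilon>)
      then have "m \<in> A \<epsilon>" by (simp add: A_def le_nat_floor inverse_eq_divide)
      then show ?case unfolding \<nu>_def by (rule Max_ge[OF fin])
    qed
  qed
  then have "\<forall>m. \<forall>\<^sub>F \<epsilon> in at_right 0. m \<le> \<nu> \<epsilon>" ..
  with 1 show ?thesis by (rule that)
qed

text \<open>The domains \<open>\<Omega>' \<epsilon>\<close> of the defining net eventually contain every compact subset of \<open>\<Omega>\<close>, but need not
  contain \<open>\<Omega>\<close>. Let \<open>\<nu> \<epsilon>\<close> tend to infinity so slowly that the support of the cutoff with index \<open>\<nu> \<epsilon>\<close> lies in
  \<open>\<Omega>' \<epsilon>\<close>. The product of this cutoff with \<open>u \<epsilon>\<close> is smooth everywhere and, on a neighbourhood of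
  any given compact set, eventually equal to \<open>u \<epsilon>\<close>.\<close>

lemma gen_smooth_fun_has_global_net:
  fixes \<Omega> :: "(real ^ 'd::finite) set" and u :: "real \<Rightarrow> real ^ 'd \<Rightarrow> real"
  assumes "open \<Omega>" and gsm: "defines_gsm (compact_gen_points \<Omega>) gen_space \<Omega>' u"
  obtains v where "\<forall>\<epsilon>\<in>{0<..1}. smooth_on \<Omega> (v \<epsilon>)"
    "\<forall>K. compact K \<and> K \<subseteq> \<Omega> \<longrightarrow>
       (\<forall>\<^sub>F \<epsilon> in at_right 0. \<forall>x\<in>K. \<forall>\<alpha>. multi_partial \<alpha> (v \<epsilon>) x = multi_partial \<alpha> (u \<epsilon>) x)"
proof -
  have op: "open (\<Omega>' \<epsilon>)" and smooth: "smooth_on (\<Omega>' \<epsilon>) (u \<epsilon>)" if "\<epsilon> \<in> {0<..1}" for \<epsilon>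
    using gsm that unfolding defines_gsm_def by blast+
  have sub: "\<forall>\<^sub>F \<epsilon> in at_right 0. K \<subseteq> \<Omega>' \<epsilon>" if "compact K" "K \<subseteq> \<Omega>" for K
    by (rule eventually_compact_subset[OF that])
      (use gsm in \<open>unfold defines_gsm_def strongly_internal_def, blast\<close>)
  obtain \<eta> :: "nat \<Rightarrow> real ^ 'd \<Rightarrow> real" and L where
    \<eta>: "\<And>n. smooth_on UNIV (\<eta> n)" and L: "\<And>n. compact (L n)" "\<And>n. L n \<subseteq> \<Omega>" "L 0 = {}"
    and \<eta>0: "\<And>n x. x \<notin> L n \<Longrightarrow> \<eta> n x = 0"
    and \<eta>1: "\<And>K. compact K \<Longrightarrow> K \<subseteq> \<Omega> \<Longrightarrow>
       \<exists>U. open U \<and> K \<subseteq> U \<and> (\<forall>\<^sub>F n in sequentially. \<forall>x\<in>U. \<eta> n x = 1)"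
    using cutoff_exhaustion[OF assms(1)] by blast
  obtain \<nu> where \<nu>: "\<forall>\<epsilon>. L (\<nu> \<epsilon>) \<subseteq> \<Omega>' \<epsilon>" "\<forall>m. \<forall>\<^sub>F \<epsilon> in at_right 0. m \<le> \<nu> \<epsilon>"
    by (rule diagonal_index[of "\<lambda>n \<epsilon>. L n \<subseteq> \<Omega>' \<epsilon>"]) (use sub L in simp_all)
  define v where "v \<epsilon> x = \<eta> (\<nu> \<epsilon>) x * u \<epsilon> x" for \<epsilon> x
  have "smooth_on \<Omega> (v \<epsilon>)" if \<epsilon>: "\<epsilon> \<in> {0<..1}" for \<epsilon>
  proof -
    have "smooth_on (\<Omega>' \<epsilon>) (v \<epsilon>)"
      unfolding v_def by (intro smooth_on_mult op smooth \<epsilon> smooth_on_subset[OF \<eta> subset_UNIV])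
    \<comment> \<open>off its support the cutoff kills the values of \<open>u \<epsilon>\<close>, whatever they are\<close>
    moreover have "open (- L (\<nu> \<epsilon>))" using L(1) compact_imp_closed by blast
    moreover from this have "smooth_on (- L (\<nu> \<epsilon>)) (v \<epsilon>)"
      by (rule smooth_on_cong[OF _ _ smooth_on_const[of _ 0]]) (simp add: v_def \<eta>0)
    ultimately have "smooth_on (\<Omega>' \<epsilon> \<union> - L (\<nu> \<epsilon>)) (v \<epsilon>)"
      using op[OF \<epsilon>] by (intro smooth_on_Un)
    then show ?thesis by (rule smooth_on_subset) (use \<nu>(1) in blast)
  qed
  moreover have "\<forall>\<^sub>F \<epsilon> in at_right 0. \<forall>x\<in>K. \<forall>\<alpha>. multi_partial \<alpha> (v \<epsilon>) x = multi_partial \<alpha> (u \<epsilon>) x"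
    if K: "compact K" "K \<subseteq> \<Omega>" for K
  proof -
    obtain U n0 where U: "open U" "K \<subseteq> U" and n0: "\<And>n x. n \<ge> n0 \<Longrightarrow> x \<in> U \<Longrightarrow> \<eta> n x = 1"
      using \<eta>1[OF K] unfolding eventually_sequentially by blast
    from \<nu>(2)[rule_format, of n0] sub[OF K] eventually_at_right_unit_interval
    show ?thesis
    proof eventually_elim
      case (elim \<epsilon>)
      have "multi_partial \<alpha> (v \<epsilon>) x = multi_partial \<alpha> (u \<epsilon>) x" if "x \<in> K" for x \<alpha>
      proof (rule multi_partial_cong[where S = "U \<inter> \<Omega>' \<epsilon>"])
        show "open (U \<inter> \<Omega>' \<epsilon>)" using U(1) op[OF elim(3)] by (rule open_Int)
        show "v \<epsilon> y = u \<epsilon> y" if "y \<in> U \<inter> \<Omega>' \<epsilon>" for y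
          using n0[OF elim(1)] that by (simp add: v_def)
        show "x \<in> U \<inter> \<Omega>' \<epsilon>" using U(2) elim(2) that by blast
      qed
      then show ?case by blast
    qed
  qed
  ultimately show ?thesis using that[of v] by blast
qed

text \<open>Moderateness of the global net on compact sets follows from moderateness of the defining net at all
  points, by testing on maximizers.\<close>

lemma gen_smooth_fun_is_colombeau_eval:
  fixes \<Omega> :: "(real ^ 'd::finite) set"
  assumes "open \<Omega>" "f \<in> gen_smooth_funs (compact_gen_points \<Omega>) (gen_space :: (real \<Rightarrow> real) set set)"
  obtains v where "v \<in> colombeau_moderate \<Omega>" "f = colombeau_eval \<Omega> (colombeau_class \<Omega> v)"
proof -
  let ?X = "compact_gen_points \<Omega>"
  obtain \<Omega>' and u :: "real \<Rightarrow> real ^ 'd \<Rightarrow> real" where f: "f \<in> ?X \<rightarrow>\<^sub>E gen_space"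
    and gsm: "defines_gsm ?X gen_space \<Omega>' u"
    and fu: "\<forall>p\<in>?X. \<forall>x\<in>p. f p = net_class (\<lambda>\<epsilon>. u \<epsilon> (x \<epsilon>))"
    using assms(2) unfolding gen_smooth_funs_def by blast
  obtain v where v: "\<forall>\<epsilon>\<in>{0<..1}. smooth_on \<Omega> (v \<epsilon>)"
    and vu: "\<forall>K. compact K \<and> K \<subseteq> \<Omega> \<longrightarrow>
       (\<forall>\<^sub>F \<epsilon> in at_right 0. \<forall>x\<in>K. \<forall>\<alpha>. multi_partial \<alpha> (v \<epsilon>) x = multi_partial \<alpha> (u \<epsilon>) x)"
    by (rule gen_smooth_fun_has_global_net[OF assms(1) gsm])
  have eq: "\<forall>\<^sub>F \<epsilon> in at_right 0. \<forall>\<alpha>. multi_partial \<alpha> (v \<epsilon>) (x \<epsilon>) = multi_partial \<alpha> (u \<epsilon>) (x \<epsilon>)"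
    if px: "p \<in> ?X" "x \<in> p" for p x
  proof -
    obtain K where K: "compact K" "K \<subseteq> \<Omega>" "\<forall>\<^sub>F \<epsilon> in at_right 0. x \<epsilon> \<in> K"
      by (rule compact_gen_point_eventually_in_compact[OF assms(1) px(1)]) (use px(2) in blast)
    from vu K(1,2) have
      "\<forall>\<^sub>F \<epsilon> in at_right 0. \<forall>x\<in>K. \<forall>\<alpha>. multi_partial \<alpha> (v \<epsilon>) x = multi_partial \<alpha> (u \<epsilon>) x" by blast
    with K(3) show ?thesis by eventually_elim blast
  qed
  have u_mod: "(\<lambda>\<epsilon>. multi_partial \<alpha> (u \<epsilon>) (x \<epsilon>)) \<in> moderate_nets" if "p \<in> ?X" "x \<in> p" for p x \<alpha>
    using gsm that unfolding defines_gsm_def by blast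
  have "locally_moderate \<Omega> (\<lambda>\<epsilon>. multi_partial \<alpha> (v \<epsilon>))" for \<alpha>
  proof (rule locally_moderate_if_moderate_at_points)
    show "\<forall>\<^sub>F \<epsilon> in at_right 0. continuous_on K (multi_partial \<alpha> (v \<epsilon>))" if "K \<subseteq> \<Omega>" for K
      by (rule eventually_continuous_on[OF _ that]) (use v in blast)
    show "(\<lambda>\<epsilon>. multi_partial \<alpha> (v \<epsilon>) (x \<epsilon>)) \<in> moderate_nets" if "p \<in> ?X" "x \<in> p" for p x
    proof -
      have "\<forall>\<^sub>F \<epsilon> in at_right 0. multi_partial \<alpha> (v \<epsilon>) (x \<epsilon>) = multi_partial \<alpha> (u \<epsilon>) (x \<epsilon>)"
        using eq[OF that] by (rule eventually_mono) blast
      from moderate_nets_cong[OF this] u_mod[OF that] show ?thesis by blast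
    qed
  qed
  then have v_mod: "v \<in> colombeau_moderate \<Omega>" using v unfolding colombeau_moderate_iff by blast
  moreover have "f = colombeau_eval \<Omega> (colombeau_class \<Omega> v)"
  proof (rule PiE_ext[OF f])
    show "colombeau_eval \<Omega> (colombeau_class \<Omega> v) \<in> ?X \<rightarrow>\<^sub>E gen_space"
      using colombeau_eval_in_gen_smooth_funs[OF assms(1) v_mod] unfolding gen_smooth_funs_def by blast
    fix p assume p: "p \<in> ?X"
    then obtain x where x: "x \<in> p" using compact_gen_points_nonempty by blast
    have "\<forall>\<^sub>F \<epsilon> in at_right 0. u \<epsilon> (x \<epsilon>) = v \<epsilon> (x \<epsilon>)"
      using eq[OF p x]
    proof eventually_elim
      case (elim \<epsilon>)
      from elim[rule_format, of "\<lambda>i. 0"] show ?case by (simp add: multi_partial_zero)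
    qed
    then have "net_class (\<lambda>\<epsilon>. u \<epsilon> (x \<epsilon>)) = net_class (\<lambda>\<epsilon>. v \<epsilon> (x \<epsilon>))"
      by (rule net_class_cong)
    then show "f p = colombeau_eval \<Omega> (colombeau_class \<Omega> v) p"
      using fu p x colombeau_eval_class[OF assms(1) v_mod p x] by simp
  qed
  ultimately show ?thesis by (rule that)
qed

theorem theorem37:
  fixes \<Omega> :: "(real ^ 'd::finite) set"
  assumes "open \<Omega>"
  shows
    "(\<forall>u\<in>colombeau_moderate \<Omega>. \<forall>p\<in>compact_gen_points \<Omega>. \<forall>x\<in>p.
        (\<lambda>\<epsilon>. u \<epsilon> (x \<epsilon>)) \<in> moderate_nets) \<and>
     (\<forall>(u, v)\<in>colombeau_rel \<Omega>. \<forall>p\<in>compact_gen_points \<Omega>. \<forall>x\<in>p. \<forall>y\<in>p.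
        net_class (\<lambda>\<epsilon>. u \<epsilon> (x \<epsilon>)) = net_class (\<lambda>\<epsilon>. v \<epsilon> (y \<epsilon>))) \<and>
     (\<forall>u\<in>colombeau_moderate \<Omega>. \<forall>p\<in>compact_gen_points \<Omega>. \<forall>x\<in>p.
        colombeau_eval \<Omega> (colombeau_class \<Omega> u) p = net_class (\<lambda>\<epsilon>. u \<epsilon> (x \<epsilon>))) \<and>
     bij_betw (colombeau_eval \<Omega>) (colombeau_algebra \<Omega>)
       (gen_smooth_funs (compact_gen_points \<Omega>) gen_space)"
proof (intro conjI)
  have algebra: "colombeau_algebra \<Omega> = colombeau_class \<Omega> ` colombeau_moderate \<Omega>"
    by (auto simp: colombeau_algebra_def colombeau_class_def quotient_def)
  show "bij_betw (colombeau_eval \<Omega>) (colombeau_algebra \<Omega>)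
       (gen_smooth_funs (compact_gen_points \<Omega>) gen_space)"
    unfolding bij_betw_def
  proof
    show "inj_on (colombeau_eval \<Omega>) (colombeau_algebra \<Omega>)"
      unfolding algebra
    proof (rule inj_onI, elim imageE)
      fix U V u v
      assume "colombeau_eval \<Omega> U = colombeau_eval \<Omega> V"
        and "U = colombeau_class \<Omega> u" "u \<in> colombeau_moderate \<Omega>"
        and "V = colombeau_class \<Omega> v" "v \<in> colombeau_moderate \<Omega>"
      then show "U = V" using colombeau_class_eq_if_eval_eq[OF assms, of u v] by simp
    qed
    show "colombeau_eval \<Omega> ` colombeau_algebra \<Omega> = gen_smooth_funs (compact_gen_points \<Omega>) gen_space"
    proof
      show "colombeau_eval \<Omega> ` colombeau_algebra \<Omega> \<subseteq> gen_smooth_funs (compact_gen_points \<Omega>) gen_space"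
        unfolding algebra using colombeau_eval_in_gen_smooth_funs[OF assms] by blast
      show "gen_smooth_funs (compact_gen_points \<Omega>) gen_space \<subseteq> colombeau_eval \<Omega> ` colombeau_algebra \<Omega>"
      proof
        fix f assume "f \<in> gen_smooth_funs (compact_gen_points \<Omega>) (gen_space :: (real \<Rightarrow> real) set set)"
        then obtain v where "v \<in> colombeau_moderate \<Omega>" "f = colombeau_eval \<Omega> (colombeau_class \<Omega> v)"
          by (rule gen_smooth_fun_is_colombeau_eval[OF assms])
        then show "f \<in> colombeau_eval \<Omega> ` colombeau_algebra \<Omega>" unfolding algebra by blast
      qed
    qed
  qed
  show "\<forall>u\<in>colombeau_moderate \<Omega>. \<forall>p\<in>compact_gen_points \<Omega>. \<forall>x\<in>p. (\<lambda>\<epsilon>. u \<epsilon> (x \<epsilon>)) \<in> moderate_nets"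
    by (intro ballI) (rule eval_at_point_moderate[OF assms])
  show "\<forall>u\<in>colombeau_moderate \<Omega>. \<forall>p\<in>compact_gen_points \<Omega>. \<forall>x\<in>p.
      colombeau_eval \<Omega> (colombeau_class \<Omega> u) p = net_class (\<lambda>\<epsilon>. u \<epsilon> (x \<epsilon>))"
    by (intro ballI) (rule colombeau_eval_class[OF assms])
  show "\<forall>(u, v)\<in>colombeau_rel \<Omega>. \<forall>p\<in>compact_gen_points \<Omega>. \<forall>x\<in>p. \<forall>y\<in>p.
      net_class (\<lambda>\<epsilon>. u \<epsilon> (x \<epsilon>)) = net_class (\<lambda>\<epsilon>. v \<epsilon> (y \<epsilon>))"
    by (intro ballI, clarify) (rule eval_at_point_rel[OF assms])
qed

end
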